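(* For all $L\ge\mu>0$, with $\kappa=L/\mu$, there exist $L$-smooth and $\mu$-strongly convex functions $f_1,\dots,f_n$ such that at least $$K(\epsilon)=\tilde\Omega\left(\left(\frac{n}{1+(\ln(n/\kappa))_+}+\sqrt{n\kappa}\right)\ln\frac1\epsilon+n\right)$$ iterations are needed for SVRG or SARAH, applied to $f=\frac1n\sum_{i=1}^n f_i$, to obtain expected suboptimality $\mathbb{E}[f(x^{K(\epsilon)})-f(x^* )]<\epsilon$.
   Context: For $a\in\mathbb{R}$, $(a)_+=\max\{a,0\}$. A function is $L$-smooth if its gradient is $L$-Lipschitz. Here $x^*$ is the minimizer of $f$ (there is no nonsmooth term, $\psi=0$). Complexity is measured by the number of component gradient evaluations $\nabla f_i$; $x^K$ is the point produced after $K$ of them, a full gradient costing $n$. The notation $\tilde\Omega$ hides absolute constants and smaller low-accuracy terms (terms that matter only for large $\epsilon$); the bound is understood for small $\epsilon$. The functions $f_i$ may depend on the number of iterations considered. SVRG: the algorithm proceeds in epochs. At the start of an epoch with current point $x^k$, set $w_0=x^k$, $g=\nabla f(w_0)$; then for each inner step $t$ draw $i_t\in\{1,\dots,n\}$ IID with fixed distribution $(p_i)$, set $\tilde\nabla_t=g+(\nabla f_{i_t}(w_t)-\nabla f_{i_t}(w_0))/(np_{i_t})$ and $w_{t+1}=w_t-\eta\tilde\nabla_t$; the number of inner steps is geometric with mean $m$, and the last inner iterate is the next $x^{k+1}$. SARAH: likewise in epochs, with $v_0=\nabla f(w_0)$, $w_1=w_0-\eta v_0$, and for $t\ge1$, $v_t=\nabla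 f_{i_t}(w_t)-\nabla f_{i_t}(w_{t-1})+v_{t-1}$ with $i_t$ uniform on $\{1,\dots,n\}$, $w_{t+1}=w_t-\eta v_t$; the next epoch starts from a randomly chosen inner iterate. Step sizes and epoch lengths are parameters chosen without dependence on gradient answers. *)

theory Defs
  imports "HOL-Probability.Probability"
begin

section \<open>Euclidean space and gradients\<close>

text \<open>
  The dimension is existentially quantified in the lower bound, so it is a natural number and
  not a type: a point of Euclidean \<open>d\<close>-space is a sequence that vanishes from index \<open>d\<close> on, and
  its norm is \<^term>\<open>L2_set x {..<d}\<close>.
\<close>

type_synonym point = "nat \<Rightarrow> real"

definition Rn :: "nat \<Rightarrow> point set" where
  "Rn d = {x. \<forall>j\<ge>d. x j = 0}"

definition has_gradient :: "nat \<Rightarrow> (point \<Rightarrow> real) \<Rightarrow> point \<Rightarrow> point \<Rightarrow> bool" where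
  "has_gradient d f g x \<longleftrightarrow>
     (\<forall>e>0. \<exists>\<delta>>0. \<forall>h\<in>Rn d. L2_set h {..<d} < \<delta> \<longrightarrow>
        \<bar>f (\<lambda>j. x j + h j) - f x - (\<Sum>j<d. g j * h j)\<bar> \<le> e * L2_set h {..<d})"

definition grad :: "nat \<Rightarrow> (point \<Rightarrow> real) \<Rightarrow> point \<Rightarrow> point" where
  "grad d f x = (THE g. g \<in> Rn d \<and> has_gradient d f g x)"

lemma has_gradient_unique:
  assumes g: "g \<in> Rn d" "has_gradient d f g x" and g': "g' \<in> Rn d" "has_gradient d f g' x"
  shows "g = g'"
proof
  fix i
  show "g i = g' i"
  proof (cases "i < d")
    case False
    then show ?thesis using g(1) g'(1) by (simp add: Rn_def)
  next
    case True
    have "\<bar>g i - g' i\<bar> \<le> e" if e: "e > 0" for e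
    proof -
      from e have e2: "e / 2 > 0" by simp
      from g(2) e2 obtain d1 where d1: "d1 > 0"
        "\<forall>h\<in>Rn d. L2_set h {..<d} < d1 \<longrightarrow>
          \<bar>f (\<lambda>j. x j + h j) - f x - (\<Sum>j<d. g j * h j)\<bar> \<le> e / 2 * L2_set h {..<d}"
        unfolding has_gradient_def by blast
      from g'(2) e2 obtain d2 where d2: "d2 > 0"
        "\<forall>h\<in>Rn d. L2_set h {..<d} < d2 \<longrightarrow>
          \<bar>f (\<lambda>j. x j + h j) - f x - (\<Sum>j<d. g' j * h j)\<bar> \<le> e / 2 * L2_set h {..<d}"
        unfolding has_gradient_def by blast
      define s where "s = min d1 d2 / 2"
      have s: "0 < s" "s < d1" "s < d2" using d1(1) d2(1) by (auto simp: s_def min_def)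
      define h where "h = (\<lambda>j. if j = i then s else 0)"
      have h: "h \<in> Rn d" using True by (auto simp: h_def Rn_def)
      have sq: "(h j)\<^sup>2 = (if j = i then s\<^sup>2 else 0)" for j by (simp add: h_def)
      have nh: "L2_set h {..<d} = s" unfolding L2_set_def sq using True s(1) by simp
      have ip: "(\<Sum>j<d. u j * h j) = u i * s" for u
        using True by (simp add: h_def if_distrib cong: if_cong)
      have "\<bar>f (\<lambda>j. x j + h j) - f x - g i * s\<bar> \<le> e / 2 * s"
        using d1(2) h nh s ip[of g] by metis
      moreover have "\<bar>f (\<lambda>j. x j + h j) - f x - g' i * s\<bar> \<le> e / 2 * s"
        using d2(2) h nh s ip[of g'] by metis
      ultimately have "\<bar>g i * s - g' i * s\<bar> \<le> e * s" by (auto simp: abs_if split: if_splits)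
      then have "\<bar>g i - g' i\<bar> * s \<le> e * s" 
        using s(1) by (simp add: abs_mult flip: left_diff_distrib)
      then show ?thesis using s(1) by simp
    qed
    then have "\<bar>g i - g' i\<bar> \<le> 0" by (rule field_le_epsilon[of _ 0, simplified])
    then show ?thesis by simp
  qed
qed

lemma grad_eqI: "g \<in> Rn d \<Longrightarrow> has_gradient d f g x \<Longrightarrow> grad d f x = g"
  unfolding grad_def by (blast intro: has_gradient_unique)

definition L_smooth :: "nat \<Rightarrow> real \<Rightarrow> (point \<Rightarrow> real) \<Rightarrow> bool" where
  "L_smooth d L f \<longleftrightarrow>
     (\<forall>x\<in>Rn d. \<exists>g\<in>Rn d. has_gradient d f g x) \<and>
     (\<forall>x\<in>Rn d. \<forall>y\<in>Rn d.
        L2_set (\<lambda>j. grad d f x j - grad d f y j) {..<d} \<le> L * L2_set (\<lambda>j. x j - y j) {..<d})"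

definition strongly_convex :: "nat \<Rightarrow> real \<Rightarrow> (point \<Rightarrow> real) \<Rightarrow> bool" where
  "strongly_convex d \<mu> f \<longleftrightarrow>
     (\<forall>x\<in>Rn d. \<forall>y\<in>Rn d. \<forall>t\<in>{0..1}.
        f (\<lambda>j. t * x j + (1 - t) * y j)
          \<le> t * f x + (1 - t) * f y - \<mu> / 2 * t * (1 - t) * (L2_set (\<lambda>j. x j - y j) {..<d})\<^sup>2)"

definition avg :: "nat \<Rightarrow> (nat \<Rightarrow> point \<Rightarrow> real) \<Rightarrow> point \<Rightarrow> real" where
  "avg n f x = (\<Sum>i=1..n. f i x) / real n"


section \<open>SVRG\<close>

text \<open>The inner steps of an epoch with snapshot \<open>w0\<close>: distribution after \<open>t\<close> further steps from \<open>w\<close>.\<close>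

primrec svrg_inner ::
  "nat \<Rightarrow> nat \<Rightarrow> (nat \<Rightarrow> point \<Rightarrow> real) \<Rightarrow> nat pmf \<Rightarrow> real \<Rightarrow> point \<Rightarrow> nat \<Rightarrow> point \<Rightarrow> point pmf" where
  "svrg_inner d n f p \<eta> w0 0 w = return_pmf w"
| "svrg_inner d n f p \<eta> w0 (Suc t) w =
     do {
       i \<leftarrow> p;
       let v = (\<lambda>j. grad d (avg n f) w0 j
                    + (grad d (f i) w j - grad d (f i) w0 j) / (real n * pmf p i));
       svrg_inner d n f p \<eta> w0 t (\<lambda>j. w j - \<eta> * v j)
     }"

text \<open>
  \<open>svrg d n f p \<eta> m k x K\<close> is the distribution of the output after \<open>K\<close> component gradient
  evaluations if epoch number \<open>k\<close> starts at \<open>x\<close>. The output is the point at the end of the last epoch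
  that fits into the budget. An epoch with \<open>N\<close> inner steps uses \<open>n + 2 * N\<close> evaluations.
  Step size and mean epoch length may vary with the epoch, and are fixed in advance.
  \<^const>\<open>geometric_pmf\<close> lives on \<open>{0, 1, 2, \<dots>}\<close>, so mean \<open>m k\<close> means success probability
  \<open>1 / (m k + 1)\<close>. The case \<open>n = 0\<close> only serves totality.
\<close>

function svrg ::
  "nat \<Rightarrow> nat \<Rightarrow> (nat \<Rightarrow> point \<Rightarrow> real) \<Rightarrow> nat pmf \<Rightarrow> (nat \<Rightarrow> real) \<Rightarrow> (nat \<Rightarrow> real)
     \<Rightarrow> nat \<Rightarrow> point \<Rightarrow> nat \<Rightarrow> point pmf" where
  "svrg d n f p \<eta> m k x K =
     (if n = 0 then return_pmf x
      else do {
        N \<leftarrow> geometric_pmf (1 / (m k + 1));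
        if K < n + 2 * N then return_pmf x
        else do {
          y \<leftarrow> svrg_inner d n f p (\<eta> k) x N x;
          svrg d n f p \<eta> m (Suc k) y (K - (n + 2 * N))
        }
      })"
  by pat_completeness auto
termination
  by (relation "Wellfounded.measure (\<lambda>(d, n, f, p, \<eta>, m, k, x, K). K)") auto

declare svrg.simps [simp del]


section \<open>SARAH\<close>

text \<open>Joint distribution of \<open>(w\<^sub>t, w\<^sub>t\<^sub>+\<^sub>1, v\<^sub>t)\<close> in an epoch started at \<open>x\<close>.\<close>

primrec sarah_inner ::
  "nat \<Rightarrow> nat \<Rightarrow> (nat \<Rightarrow> point \<Rightarrow> real) \<Rightarrow> real \<Rightarrow> point \<Rightarrow> nat \<Rightarrow> (point \<times> point \<times> point) pmf" where
  "sarah_inner d n f \<eta> x 0 =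
     (let v = grad d (avg n f) x in return_pmf (x, (\<lambda>j. x j - \<eta> * v j), v))"
| "sarah_inner d n f \<eta> x (Suc t) =
     do {
       (u, w, v) \<leftarrow> sarah_inner d n f \<eta> x t;
       i \<leftarrow> pmf_of_set {1..n};
       let v' = (\<lambda>j. grad d (f i) w j - grad d (f i) u j + v j);
       return_pmf (w, (\<lambda>j. w j - \<eta> * v' j), v')
     }"

text \<open>
  An epoch of length \<open>m k\<close> computes \<open>w\<^sub>0, \<dots>, w\<^sub>m\<close> from \<open>v\<^sub>0, \<dots>, v\<^sub>m\<^sub>-\<^sub>1\<close>, which uses
  \<open>n + 2 * (m k - 1)\<close> evaluations, and passes on \<open>w\<^sub>T\<close> with \<open>T\<close> uniform on \<open>{0..m k}\<close>. As \<open>T\<close> is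
  independent of the sampled components, only the marginal law of \<open>w\<^sub>T\<close> matters.
\<close>

function sarah ::
  "nat \<Rightarrow> nat \<Rightarrow> (nat \<Rightarrow> point \<Rightarrow> real) \<Rightarrow> (nat \<Rightarrow> real) \<Rightarrow> (nat \<Rightarrow> nat)
     \<Rightarrow> nat \<Rightarrow> point \<Rightarrow> nat \<Rightarrow> point pmf" where
  "sarah d n f \<eta> m k x K =
     (if n = 0 \<or> K < n + 2 * (m k - 1) then return_pmf x
      else do {
        T \<leftarrow> pmf_of_set {0..m k};
        (y, _, _) \<leftarrow> sarah_inner d n f (\<eta> k) x T;
        sarah d n f \<eta> m (Suc k) y (K - (n + 2 * (m k - 1)))
      })"
  by pat_completeness auto
termination
  by (relation "Wellfounded.measure (\<lambda>(d, n, f, \<eta>, m, k, x, K). K)") auto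

declare sarah.simps [simp del]

end

theory Submission
  imports Defs
begin

text \<open>
  Let \<open>f\<^sub>i\<close> be the sum of a quadratic chain on its own block of coordinates and \<open>\<mu> / 2\<close> times the
  squared norm. Evaluating the gradient of \<open>f\<^sub>i\<close> extends the support of the iterates by at most one
  coordinate, in block \<open>i\<close>, and a full gradient, which costs \<open>n\<close>, extends it by one coordinate in
  each of the \<open>n\<close> blocks. After \<open>K\<close> evaluations some block has at most \<open>K / n\<close> explored coordinates,
  whatever the step sizes, the epoch lengths and the samples are. The minimizer decays along a block
  like \<open>q\<^sup>j\<close> with \<open>ln (1 / q) = 2 * arsinh (sqrt (n / (\<kappa> - 1)))\<close>, so the suboptimality is at least of
  order \<open>q\<close> to the power \<open>2 * K / n\<close>. This is the claimed rate if \<open>\<kappa> \<ge> 2\<close>.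

  For \<open>\<kappa>\<close> near \<open>1\<close> the chain degenerates, and the randomness of the epochs matters instead: an epoch
  can return its starting point, and balancing that probability against the cost of long epochs shows
  that no progress at all is made with probability at least \<open>exp (- 2 * (1 + ln n) * K / n)\<close>.
\<close>

section \<open>Quadratic functions on Euclidean space\<close>

lemma L2_set_power2: "(L2_set h A)\<^sup>2 = (\<Sum>i\<in>A. (h i)\<^sup>2)"
  by (simp add: L2_set_def sum_nonneg)

lemma Rn_add: "x \<in> Rn d \<Longrightarrow> y \<in> Rn d \<Longrightarrow> (\<lambda>j. x j + y j) \<in> Rn d"
  and Rn_diff: "x \<in> Rn d \<Longrightarrow> y \<in> Rn d \<Longrightarrow> (\<lambda>j. x j - y j) \<in> Rn d"
  and Rn_scale: "x \<in> Rn d \<Longrightarrow> (\<lambda>j. c * x j) \<in> Rn d"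
  and Rn_uminus: "x \<in> Rn d \<Longrightarrow> (\<lambda>j. - x j) \<in> Rn d"
  by (auto simp: Rn_def)

text \<open>The remainder \<open>R\<close> does not depend on the base point, so \<open>f\<close> is
  quadratic with gradient \<open>G\<close>. Smoothness, strong convexity and optimality are derived
  once here, for the components and for their average.\<close>

locale quadratic =
  fixes d :: nat and f :: "point \<Rightarrow> real" and G :: "point \<Rightarrow> point" and R :: "point \<Rightarrow> real"
    and L \<mu> :: real
  assumes G_Rn: "x \<in> Rn d \<Longrightarrow> G x \<in> Rn d"
    and expansion: "x \<in> Rn d \<Longrightarrow> h \<in> Rn d \<Longrightarrow>
      f (\<lambda>j. x j + h j) = f x + (\<Sum>j<d. G x j * h j) + R h"
    and R_ge: "h \<in> Rn d \<Longrightarrow> \<mu> / 2 * (L2_set h {..<d})\<^sup>2 \<le> R h"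
    and G_lipschitz: "x \<in> Rn d \<Longrightarrow> y \<in> Rn d \<Longrightarrow>
      L2_set (\<lambda>j. G x j - G y j) {..<d} \<le> L * L2_set (\<lambda>j. x j - y j) {..<d}"
    and mu_nonneg: "0 \<le> \<mu>"
begin

lemma R_nonneg: "h \<in> Rn d \<Longrightarrow> 0 \<le> R h"
  by (rule order_trans[OF _ R_ge]) (use mu_nonneg in auto)

text \<open>Expanding from \<open>x\<close> to \<open>x + h\<close> and back gives
  \<open>R h + R (- h)\<close> as the inner product of \<open>G (x + h) - G x\<close> with
  \<open>h\<close>. Cauchy-Schwarz and the Lipschitz bound apply, and \<open>R (- h)\<close> is
  dropped as nonnegative.\<close>

lemma R_le:
  assumes x: "x \<in> Rn d" and h: "h \<in> Rn d"
  shows "R h \<le> L * (L2_set h {..<d})\<^sup>2"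
proof -
  let ?y = "\<lambda>j. x j + h j" and ?m = "\<lambda>j. - h j"
  have y: "?y \<in> Rn d" using x h by (rule Rn_add)
  have m: "?m \<in> Rn d" using h by (rule Rn_uminus)
  have "f x = f ?y - (\<Sum>j<d. G ?y j * h j) + R ?m"
    using expansion[OF y m] by (simp add: sum_negf)
  with expansion[OF x h] have "R h + R ?m = (\<Sum>j<d. (G ?y j - G x j) * h j)"
    by (simp add: left_diff_distrib sum_subtractf)
  also have "\<dots> \<le> (\<Sum>j<d. \<bar>G ?y j - G x j\<bar> * \<bar>h j\<bar>)"
    by (intro sum_mono) (metis abs_ge_self abs_mult)
  also have "\<dots> \<le> L2_set (\<lambda>j. G ?y j - G x j) {..<d} * L2_set h {..<d}"
    by (rule L2_set_mult_ineq)
  also have "\<dots> \<le> (L * L2_set h {..<d}) * L2_set h {..<d}"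
    using G_lipschitz[OF y x] by (intro mult_right_mono) auto
  finally show ?thesis using R_nonneg[OF m] by (simp add: power2_eq_square mult.assoc)
qed

lemma has_gradient: assumes x: "x \<in> Rn d" shows "has_gradient d f (G x) x"
  unfolding has_gradient_def
proof (intro allI impI)
  fix e :: real assume e: "0 < e"
  show "\<exists>\<delta>>0. \<forall>h\<in>Rn d. L2_set h {..<d} < \<delta> \<longrightarrow>
     \<bar>f (\<lambda>j. x j + h j) - f x - (\<Sum>j<d. G x j * h j)\<bar> \<le> e * L2_set h {..<d}"
  proof (intro exI conjI ballI impI)
    \<comment> \<open>The sign of \<open>L\<close> is not assumed; adding 1 to its absolute value
      keeps the radius positive.\<close>
    show "0 < e / (\<bar>L\<bar> + 1)" using e by (simp add: add_nonneg_pos)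
    fix h assume h: "h \<in> Rn d" and small: "L2_set h {..<d} < e / (\<bar>L\<bar> + 1)"
    have "(\<bar>L\<bar> + 1) * L2_set h {..<d} \<le> e"
      using small by (simp add: field_simps add_nonneg_pos)
    moreover have "L * L2_set h {..<d} \<le> (\<bar>L\<bar> + 1) * L2_set h {..<d}"
      by (intro mult_right_mono) auto
    ultimately have "L * L2_set h {..<d} * L2_set h {..<d} \<le> e * L2_set h {..<d}"
      by (intro mult_right_mono) auto
    then have "R h \<le> e * L2_set h {..<d}"
      using R_le[OF x h] by (simp add: power2_eq_square mult.assoc)
    then show "\<bar>f (\<lambda>j. x j + h j) - f x - (\<Sum>j<d. G x j * h j)\<bar> \<le> e * L2_set h {..<d}"
      using expansion[OF x h] R_nonneg[OF h] by simp
  qed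
qed

lemma grad_eq: "x \<in> Rn d \<Longrightarrow> grad d f x = G x"
  by (intro grad_eqI G_Rn has_gradient)

lemma L_smooth: "L_smooth d L f"
  unfolding L_smooth_def using has_gradient G_Rn G_lipschitz by (auto simp: grad_eq)

text \<open>Both endpoints are expanded around the convex combination. In the weighted mean the
  linear terms cancel, and the quadratic ones add up by
  \<open>t * (1 - t)^2 + (1 - t) * t^2 = t * (1 - t)\<close>.\<close>

lemma strongly_convex: "strongly_convex d \<mu> f"
  unfolding strongly_convex_def
proof (intro ballI)
  fix x y and t :: real
  assume x: "x \<in> Rn d" and y: "y \<in> Rn d" and t: "t \<in> {0..1}"
  let ?z = "\<lambda>j. t * x j + (1 - t) * y j"
  let ?h = "\<lambda>j. x j - y j"
  let ?I = "\<Sum>j<d. G ?z j * ?h j" and ?D = "(L2_set ?h {..<d})\<^sup>2"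
  have z: "?z \<in> Rn d" by (intro Rn_add Rn_scale x y)
  have h: "(\<lambda>j. c * ?h j) \<in> Rn d" for c by (intro Rn_scale Rn_diff x y)
  have sq: "(L2_set (\<lambda>j. c * ?h j) {..<d})\<^sup>2 = c\<^sup>2 * ?D" for c
    by (simp add: L2_set_power2 power_mult_distrib sum_distrib_left)
  have ge: "f (\<lambda>j. ?z j + c * ?h j) \<ge> f ?z + c * ?I + \<mu> / 2 * (c\<^sup>2 * ?D)" for c
    using R_ge[OF h, of c] expansion[OF z h, of c]
    by (simp add: sq sum_distrib_left mult.left_commute)
  have "f x \<ge> f ?z + (1 - t) * ?I + \<mu> / 2 * ((1 - t)\<^sup>2 * ?D)"
    using ge[of "1 - t"] by (simp add: algebra_simps)
  moreover have "f y \<ge> f ?z + (- t) * ?I + \<mu> / 2 * ((- t)\<^sup>2 * ?D)"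
    using ge[of "- t"] by (simp add: algebra_simps)
  ultimately have "t * f x + (1 - t) * f y \<ge>
      t * (f ?z + (1 - t) * ?I + \<mu> / 2 * ((1 - t)\<^sup>2 * ?D))
      + (1 - t) * (f ?z + (- t) * ?I + \<mu> / 2 * ((- t)\<^sup>2 * ?D))"
    using t by (intro add_mono mult_left_mono) auto
  also have "t * (f ?z + (1 - t) * ?I + \<mu> / 2 * ((1 - t)\<^sup>2 * ?D))
      + (1 - t) * (f ?z + (- t) * ?I + \<mu> / 2 * ((- t)\<^sup>2 * ?D))
    = f ?z + \<mu> / 2 * t * (1 - t) * ?D"
    by (simp add: field_simps power2_eq_square)
  finally show "f ?z \<le> t * f x + (1 - t) * f y - \<mu> / 2 * t * (1 - t) * ?D" by simp
qed

text \<open>Turns a coordinate that is still wrong into a lower bound on the suboptimality.\<close>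

lemma growth:
  assumes xs: "xs \<in> Rn d" "\<And>j. j < d \<Longrightarrow> G xs j = 0" and x: "x \<in> Rn d"
  shows "\<mu> / 2 * (L2_set (\<lambda>j. x j - xs j) {..<d})\<^sup>2 \<le> f x - f xs"
  using expansion[OF xs(1) Rn_diff[OF x xs(1)]] R_ge[OF Rn_diff[OF x xs(1)]] xs(2) by simp

lemma is_arg_min_stationary:
  assumes "xs \<in> Rn d" "\<And>j. j < d \<Longrightarrow> G xs j = 0"
  shows "is_arg_min f (\<lambda>x. x \<in> Rn d) xs"
proof -
  have "f xs \<le> f x" if x: "x \<in> Rn d" for x
  proof -
    have "0 \<le> \<mu> / 2 * (L2_set (\<lambda>j. x j - xs j) {..<d})\<^sup>2" using mu_nonneg by simp
    also have "\<dots> \<le> f x - f xs" using growth[OF assms x] .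
    finally show ?thesis by simp
  qed
  with assms(1) show ?thesis by (auto simp: is_arg_min_def not_less)
qed

end

section \<open>Chains\<close>

text \<open>
  \<open>n\<close> interleaved chains in dimension \<open>d\<close>: coordinate \<open>k\<close> belongs to chain \<open>k mod n\<close> and its
  neighbours are \<open>k - n\<close> and \<open>k + n\<close>. The weight \<open>e\<close> is constant along chains; the indicator of one
  chain gives a component and a constant gives the average.
\<close>

definition chain_diff :: "nat \<Rightarrow> real \<Rightarrow> point \<Rightarrow> nat \<Rightarrow> real" where
  "chain_diff n s y k = y k - (if k < n then s else y (k - n))"

text \<open>The value \<open>s\<close> in front of each chain is the only inhomogeneity, so
  \<open>s = 0\<close> leaves the quadratic form that serves as remainder. The weight
  \<open>\<gamma>\<close> acts only at the last coordinate of a chain, to compensate for the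
  truncation of an infinite chain.\<close>

definition chain :: "nat \<Rightarrow> nat \<Rightarrow> real \<Rightarrow> real \<Rightarrow> real \<Rightarrow> (nat \<Rightarrow> real) \<Rightarrow> point \<Rightarrow> real" where
  "chain n d \<mu> \<gamma> s e y =
     (\<Sum>k<d. e k / 2 * ((chain_diff n s y k)\<^sup>2 + (if k + n < d then 0 else \<gamma> * (y k)\<^sup>2))
            + \<mu> / 2 * (y k)\<^sup>2)"

definition chain_grad :: "nat \<Rightarrow> nat \<Rightarrow> real \<Rightarrow> real \<Rightarrow> real \<Rightarrow> (nat \<Rightarrow> real) \<Rightarrow> point \<Rightarrow> point" where
  "chain_grad n d \<mu> \<gamma> s e y k =
     (if k < d then e k * (chain_diff n s y k
         + (if k + n < d then - chain_diff n s y (k + n) else \<gamma> * y k)) + \<mu> * y k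
      else 0)"

lemma sum_shift:
  fixes g :: "nat \<Rightarrow> real"
  shows "(\<Sum>k<d. if k < n then 0 else g k) = (\<Sum>k<d. if k + n < d then g (k + n) else 0)"
proof -
  have "(\<Sum>k<d. if k < n then 0 else g k) = (\<Sum>k\<in>{n..<d}. g k)"
    by (rule sum.mono_neutral_cong_right) auto
  also have "\<dots> = (\<Sum>k\<in>{k. k + n < d}. g (k + n))"
    by (rule sum.reindex_bij_witness[of _ "\<lambda>k. k + n" "\<lambda>k. k - n"]) auto
  also have "\<dots> = (\<Sum>k<d. if k + n < d then g (k + n) else 0)"
    by (rule sum.mono_neutral_cong_left) auto
  finally show ?thesis .
qed

text \<open>Summation by parts, via \<open>sum_shift\<close>, moves the difference operator from
  \<open>h\<close> to \<open>y\<close>. Constancy of \<open>e\<close> along chains makes the weights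
  of neighbouring terms agree.\<close>

lemma chain_expansion:
  assumes e: "\<And>k. e (k + n) = e k" and "0 < n"
  shows "chain n d \<mu> \<gamma> s e (\<lambda>j. y j + h j) =
    chain n d \<mu> \<gamma> s e y + (\<Sum>j<d. chain_grad n d \<mu> \<gamma> s e y j * h j) + chain n d \<mu> \<gamma> 0 e h"
proof -
  let ?D = "chain_diff n s y"
  have D: "chain_diff n s (\<lambda>j. y j + h j) k = ?D k + chain_diff n 0 h k" for k
    by (simp add: chain_diff_def)
  have "(\<Sum>k<d. e k * ?D k * chain_diff n 0 h k)
      = (\<Sum>k<d. e k * ?D k * h k) - (\<Sum>k<d. if k < n then 0 else e k * ?D k * h (k - n))"
    by (simp add: chain_diff_def algebra_simps if_distrib flip: sum_subtractf cong: if_cong)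
  also have "\<dots> = (\<Sum>k<d. e k * ?D k * h k)
      - (\<Sum>k<d. if k + n < d then e k * ?D (k + n) * h k else 0)"
    by (subst sum_shift) (simp add: e cong: if_cong)
  finally have cross: "(\<Sum>k<d. e k * ?D k * chain_diff n 0 h k) =
    (\<Sum>k<d. e k * ?D k * h k - (if k + n < d then e k * ?D (k + n) * h k else 0))"
    by (simp add: sum_subtractf)
  have "chain n d \<mu> \<gamma> s e (\<lambda>j. y j + h j) - chain n d \<mu> \<gamma> s e y - chain n d \<mu> \<gamma> 0 e h =
     (\<Sum>k<d. e k * ?D k * chain_diff n 0 h k
        + (e k * (if k + n < d then 0 else \<gamma> * y k) + \<mu> * y k) * h k)"
    unfolding chain_def D sum_subtractf[symmetric]
    by (intro sum.cong refl) (simp add: power2_eq_square field_simps)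
  also have "\<dots> = (\<Sum>k<d. e k * ?D k * h k - (if k + n < d then e k * ?D (k + n) * h k else 0)
        + (e k * (if k + n < d then 0 else \<gamma> * y k) + \<mu> * y k) * h k)"
    by (simp add: sum.distrib cross)
  also have "\<dots> = (\<Sum>j<d. chain_grad n d \<mu> \<gamma> s e y j * h j)"
    by (intro sum.cong refl) (simp add: chain_grad_def algebra_simps)
  finally show ?thesis by simp
qed

lemma L2_set_shift_down: 
  assumes "h \<in> Rn d" shows "L2_set (\<lambda>k. h (k + n)) {..<d} \<le> L2_set h {..<d}"
proof -
  have "(\<Sum>k<d. (h (k + n))\<^sup>2) = (\<Sum>k<d. if k + n < d then (h (k + n))\<^sup>2 else 0)"
    using assms by (intro sum.cong) (auto simp: Rn_def)
  also have "\<dots> = (\<Sum>k<d. if k < n then 0 else (h k)\<^sup>2)" by (rule sum_shift[symmetric])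
  also have "\<dots> \<le> (\<Sum>k<d. (h k)\<^sup>2)" by (intro sum_mono) auto
  finally show ?thesis by (simp add: L2_set_def)
qed

lemma L2_set_shift_up:
  fixes h :: point
  shows "L2_set (\<lambda>k. if k < n then 0 else h (k - n)) {..<d} \<le> L2_set h {..<d}"
proof -
  have "(\<Sum>k<d. (if k < n then 0 else h (k - n))\<^sup>2) = (\<Sum>k<d. if k < n then 0 else (h (k - n))\<^sup>2)"
    by (intro sum.cong) auto
  also have "\<dots> = (\<Sum>k<d. if k + n < d then (h k)\<^sup>2 else 0)" by (subst sum_shift) (simp cong: if_cong)
  also have "\<dots> \<le> (\<Sum>k<d. (h k)\<^sup>2)" by (intro sum_mono) auto
  finally show ?thesis by (simp add: L2_set_def)
qed

text \<open>Up to the factor \<open>e k\<close>, the operator is at most twice the identity minus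
  the two shifts along a chain, and shifts do not increase the norm. Hence the factor 4.\<close>

lemma chain_grad_bound:
  assumes h: "h \<in> Rn d" and e: "\<And>k. 0 \<le> e k" "\<And>k. e k \<le> a"
    and \<gamma>: "0 \<le> \<gamma>" "\<gamma> \<le> 1" and \<mu>: "0 \<le> \<mu>"
  shows "L2_set (chain_grad n d \<mu> \<gamma> 0 e h) {..<d} \<le> (4 * a + \<mu>) * L2_set h {..<d}"
proof -
  have a: "0 \<le> a" using order_trans[OF e] .
  let ?u = "\<lambda>k. if k < n then 0 else h (k - n)" and ?v = "\<lambda>k. h (k + n)"
  have pw: "\<bar>chain_grad n d \<mu> \<gamma> 0 e h k\<bar>
      \<le> (2 * a + \<mu>) * \<bar>h k\<bar> + (a * \<bar>?u k\<bar> + a * \<bar>?v k\<bar>)" if k: "k < d" for k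
  proof -
    \<comment> \<open>\<open>c = 2\<close> inside a chain and \<open>1 + \<gamma>\<close> at its
      end, where the missing neighbour reads as 0 because \<open>h\<close> lies in
      \<open>Rn d\<close>.\<close>
    obtain c where c: "0 \<le> c" "c \<le> 2"
      and eq: "chain_grad n d \<mu> \<gamma> 0 e h k = e k * (c * h k - ?u k - ?v k) + \<mu> * h k"
    proof (cases "k + n < d")
      case True
      with that[of 2] k show ?thesis by (simp add: chain_grad_def chain_diff_def algebra_simps)
    next
      case False
      then have "h (k + n) = 0" using h by (simp add: Rn_def)
      with that[of "1 + \<gamma>"] k False \<gamma> show ?thesis
        by (simp add: chain_grad_def chain_diff_def algebra_simps)
    qed
    have "\<bar>c * h k - ?u k - ?v k\<bar> \<le> \<bar>c * h k\<bar> + \<bar>?u k\<bar> + \<bar>?v k\<bar>" by linarith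
    also have "\<bar>c * h k\<bar> \<le> 2 * \<bar>h k\<bar>" using c by (simp add: abs_mult mult_right_mono)
    finally have "e k * \<bar>c * h k - ?u k - ?v k\<bar> \<le> a * (2 * \<bar>h k\<bar> + \<bar>?u k\<bar> + \<bar>?v k\<bar>)"
      using e[of k] a by (intro mult_mono) auto
    moreover have "\<bar>chain_grad n d \<mu> \<gamma> 0 e h k\<bar> \<le> e k * \<bar>c * h k - ?u k - ?v k\<bar> + \<mu> * \<bar>h k\<bar>"
      unfolding eq using e(1)[of k] \<mu> by (intro order_trans[OF abs_triangle_ineq]) (simp add: abs_mult)
    ultimately show ?thesis by (simp add: algebra_simps)
  qed
  have "L2_set (chain_grad n d \<mu> \<gamma> 0 e h) {..<d} = L2_set (\<lambda>k. \<bar>chain_grad n d \<mu> \<gamma> 0 e h k\<bar>) {..<d}"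
    by (simp add: L2_set_def)
  also have "\<dots> \<le> L2_set (\<lambda>k. (2 * a + \<mu>) * \<bar>h k\<bar> + (a * \<bar>?u k\<bar> + a * \<bar>?v k\<bar>)) {..<d}"
    by (intro L2_set_mono pw) auto
  also have "\<dots> \<le> L2_set (\<lambda>k. (2 * a + \<mu>) * \<bar>h k\<bar>) {..<d}
      + (L2_set (\<lambda>k. a * \<bar>?u k\<bar>) {..<d} + L2_set (\<lambda>k. a * \<bar>?v k\<bar>) {..<d})"
    by (intro order_trans[OF L2_set_triangle_ineq] add_left_mono L2_set_triangle_ineq)
  also have "\<dots> = (2 * a + \<mu>) * L2_set h {..<d} + (a * L2_set ?u {..<d} + a * L2_set ?v {..<d})"
  proof -
    have "L2_set (\<lambda>k. c * \<bar>g k\<bar>) {..<d} = c * L2_set g {..<d}" if "0 \<le> c" for c g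
      using that by (simp add: L2_set_def power_mult_distrib real_sqrt_mult flip: sum_distrib_left)
    then show ?thesis using a \<mu> by simp
  qed
  also have "\<dots> \<le> (2 * a + \<mu>) * L2_set h {..<d} + (a * L2_set h {..<d} + a * L2_set h {..<d})"
    by (intro add_mono mult_left_mono order_refl a L2_set_shift_up L2_set_shift_down h)
  finally show ?thesis by (simp add: algebra_simps)
qed

text \<open>The boundary value \<open>s\<close> cancels in a difference of gradients, which reduces
  the Lipschitz bound to the homogeneous operator.\<close>

lemma quadratic_chain:
  assumes e: "\<And>k. 0 \<le> e k" "\<And>k. e k \<le> a" "\<And>k. e (k + n) = e k"
    and \<gamma>: "0 \<le> \<gamma>" "\<gamma> \<le> 1" and \<mu>: "0 \<le> \<mu>" and n: "0 < n" and x0: "x0 \<in> Rn d"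
  shows "quadratic d (\<lambda>x. chain n d \<mu> \<gamma> s e (\<lambda>j. x j - x0 j))
     (\<lambda>x. chain_grad n d \<mu> \<gamma> s e (\<lambda>j. x j - x0 j)) (chain n d \<mu> \<gamma> 0 e) (4 * a + \<mu>) \<mu>"
proof
  show "chain_grad n d \<mu> \<gamma> s e (\<lambda>j. x j - x0 j) \<in> Rn d" for x
    by (simp add: Rn_def chain_grad_def)
  show "chain n d \<mu> \<gamma> s e (\<lambda>j. x j + h j - x0 j) = chain n d \<mu> \<gamma> s e (\<lambda>j. x j - x0 j)
     + (\<Sum>j<d. chain_grad n d \<mu> \<gamma> s e (\<lambda>j. x j - x0 j) j * h j) + chain n d \<mu> \<gamma> 0 e h" for x h
    using chain_expansion[where e = e and n = n and y = "\<lambda>j. x j - x0 j" and h = h, OF e(3) n]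
    by (simp add: add_diff_eq diff_add_eq)
  show "\<mu> / 2 * (L2_set h {..<d})\<^sup>2 \<le> chain n d \<mu> \<gamma> 0 e h" for h
    unfolding L2_set_power2 sum_distrib_left chain_def
    by (intro sum_mono) (use e(1) \<gamma> in simp)
  show "L2_set (\<lambda>j. chain_grad n d \<mu> \<gamma> s e (\<lambda>j. x j - x0 j) j
          - chain_grad n d \<mu> \<gamma> s e (\<lambda>j. y j - x0 j) j) {..<d}
     \<le> (4 * a + \<mu>) * L2_set (\<lambda>j. x j - y j) {..<d}" if "x \<in> Rn d" "y \<in> Rn d" for x y
  proof -
    have "(\<lambda>j. chain_grad n d \<mu> \<gamma> s e (\<lambda>j. x j - x0 j) j
          - chain_grad n d \<mu> \<gamma> s e (\<lambda>j. y j - x0 j) j) = chain_grad n d \<mu> \<gamma> 0 e (\<lambda>j. x j - y j)"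
      by (rule ext) (simp add: chain_grad_def chain_diff_def algebra_simps)
    then show ?thesis using chain_grad_bound[OF Rn_diff[OF that] e(1,2) \<gamma> \<mu>] by simp
  qed
qed (rule \<mu>)

section \<open>Progress along the chains\<close>

text \<open>
  \<open>r b\<close> is the number of coordinates of chain \<open>b\<close> that may differ from those of \<open>z\<close>.
\<close>

definition reach :: "nat \<Rightarrow> nat \<Rightarrow> point \<Rightarrow> (nat \<Rightarrow> nat) \<Rightarrow> point \<Rightarrow> bool" where
  "reach n d z r x \<longleftrightarrow> x \<in> Rn d \<and> (\<forall>k. r (k mod n) \<le> k div n \<longrightarrow> x k = z k)"

lemma reach_mono: "reach n d z r x \<Longrightarrow> (\<And>b. r b \<le> r' b) \<Longrightarrow> reach n d z r' x"
  unfolding reach_def by (meson order_trans)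

lemma reach_Rn: "reach n d z r x \<Longrightarrow> x \<in> Rn d"
  by (simp add: reach_def)

text \<open>Iterates are compared with the starting point, directions with 0; a step along a
  direction preserves a common profile \<open>r\<close>.\<close>

lemma reach_diff_scale:
  assumes "reach n d z r x" "reach n d (\<lambda>_. 0) r v"
  shows "reach n d z r (\<lambda>j. x j - c * v j)"
  using assms by (auto simp: reach_def Rn_def)

lemma reach_zero_add:
  assumes "reach n d (\<lambda>_. 0) r u" "reach n d (\<lambda>_. 0) r v"
  shows "reach n d (\<lambda>_. 0) r (\<lambda>j. u j + v j)"
  using assms by (auto simp: reach_def Rn_def)

lemma reach_zero_diff:
  assumes "reach n d (\<lambda>_. 0) r u" "reach n d (\<lambda>_. 0) r v"
  shows "reach n d (\<lambda>_. 0) r (\<lambda>j. (u j - v j) / c)"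
  using assms by (auto simp: reach_def Rn_def)

text \<open>Components are numbered from 1 and chains from 0; reducing modulo \<open>n\<close>
  assigns chain 0 to component \<open>n\<close>.\<close>

definition advance :: "nat \<Rightarrow> nat \<Rightarrow> (nat \<Rightarrow> nat) \<Rightarrow> nat \<Rightarrow> nat" where
  "advance n i r = r(i mod n := Suc (r (i mod n)))"

lemma advance_ge: "r b \<le> advance n i r b"
  and advance_mono: "(\<And>b. r b \<le> r' b) \<Longrightarrow> advance n i r b \<le> advance n i r' b"
  by (auto simp: advance_def)

lemma sum_advance: "0 < n \<Longrightarrow> sum (advance n i r) {..<n} = Suc (sum r {..<n})"
  by (simp add: advance_def sum.remove[of "{..<n}" "i mod n"])

section \<open>Support growth under the updates of SVRG and SARAH\<close>

locale zero_chain =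
  fixes n d :: nat and x0 :: point and f :: "nat \<Rightarrow> point \<Rightarrow> real"
  assumes n_pos: "0 < n"
    and component: "reach n d x0 r x \<Longrightarrow> i \<in> {1..n} \<Longrightarrow> reach n d (\<lambda>_. 0) (advance n i r) (grad d (f i) x)"
    and full: "reach n d x0 r x \<Longrightarrow> reach n d (\<lambda>_. 0) (\<lambda>b. Suc (r b)) (grad d (avg n f) x)"
begin

text \<open>The premise \<open>Suc (r0 b) \<le> r b\<close> pays for the full gradient at the
  snapshot in advance. Then all three terms of the estimator fit into one advance of chain
  \<open>i\<close>, although the step is charged two evaluations.\<close>

lemma svrg_inner_reach:
  assumes p: "set_pmf p \<subseteq> {1..n}" and w0: "reach n d x0 r0 w0"
  shows "reach n d x0 r w \<Longrightarrow> (\<And>b. Suc (r0 b) \<le> r b) \<Longrightarrow> y \<in> set_pmf (svrg_inner d n f p \<eta> w0 t w)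
    \<Longrightarrow> \<exists>r'. reach n d x0 r' y \<and> sum r' {..<n} \<le> sum r {..<n} + t"
proof (induction t arbitrary: w r)
  case 0
  then show ?case by auto
next
  case (Suc t)
  let ?v = "\<lambda>i j. grad d (avg n f) w0 j + (grad d (f i) w j - grad d (f i) w0 j) / (real n * pmf p i)"
  from Suc.prems(3) obtain i where i: "i \<in> set_pmf p"
    and y: "y \<in> set_pmf (svrg_inner d n f p \<eta> w0 t (\<lambda>j. w j - \<eta> * ?v i j))"
    by (auto simp: Let_def)
  from i p have i': "i \<in> {1..n}" by auto
  let ?r = "advance n i r"
  have le: "Suc (r0 b) \<le> ?r b" for b using Suc.prems(2)[of b] advance_ge[of r b n i] by linarith
  have "reach n d (\<lambda>_. 0) ?r (grad d (avg n f) w0)" by (rule reach_mono[OF full[OF w0] le])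
  moreover have "reach n d (\<lambda>_. 0) ?r (grad d (f i) w)" using component[OF Suc.prems(1) i'] .
  moreover have "reach n d (\<lambda>_. 0) ?r (grad d (f i) w0)"
    by (rule reach_mono[OF component[OF w0 i']] advance_mono)+ (use Suc.prems(2) Suc_leD in blast)
  ultimately have "reach n d (\<lambda>_. 0) ?r (?v i)" by (intro reach_zero_add reach_zero_diff)
  then have "reach n d x0 ?r (\<lambda>j. w j - \<eta> * ?v i j)"
    by (intro reach_diff_scale reach_mono[OF Suc.prems(1)] advance_ge)
  from Suc.IH[OF this le y] show ?case by (auto simp: sum_advance n_pos)
qed

lemma svrg_reach:
  assumes p: "set_pmf p \<subseteq> {1..n}"
  shows "reach n d x0 r x \<Longrightarrow> y \<in> set_pmf (svrg d n f p \<eta> m k x K) \<Longrightarrow>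
    \<exists>r'. reach n d x0 r' y \<and> sum r' {..<n} \<le> sum r {..<n} + K"
proof (induction K arbitrary: r x k rule: less_induct)
  case (less K)
  show ?case
  \<comment> \<open>An epoch beyond the budget returns \<open>x\<close>, so
    \<open>y \<noteq> x\<close> forces a completed epoch. Its growth \<open>n + N\<close> is covered
    by its cost \<open>n + 2 * N\<close>.\<close>
  proof (cases "y = x")
    case True
    with less.prems(1) show ?thesis by auto
  next
    case False
    with less.prems(2) n_pos obtain N z where N: "n + 2 * N \<le> K"
      and z: "z \<in> set_pmf (svrg_inner d n f p (\<eta> k) x N x)"
      and y: "y \<in> set_pmf (svrg d n f p \<eta> m (Suc k) z (K - (n + 2 * N)))"
      by (subst (asm) svrg.simps) (auto split: if_splits simp: not_less)
    have "reach n d x0 (\<lambda>b. Suc (r b)) x" by (rule reach_mono[OF less.prems(1)]) simp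
    from svrg_inner_reach[OF p less.prems(1) this _ z] obtain r1 where
      r1: "reach n d x0 r1 z" "sum r1 {..<n} \<le> sum (\<lambda>b. Suc (r b)) {..<n} + N" by auto
    then have "sum r1 {..<n} \<le> sum r {..<n} + n + N" by (simp add: sum_Suc)
    moreover from less.IH[OF _ r1(1) y] N n_pos obtain r2 where
      "reach n d x0 r2 y" "sum r2 {..<n} \<le> sum r1 {..<n} + (K - (n + 2 * N))" by auto
    ultimately show ?thesis using N by (intro exI[of _ r2]) auto
  qed
qed

text \<open>Each step needs gradients at two consecutive points, so two nested profiles are carried
  along. The older point lags one step behind; this \<open>t - 1\<close> is what matches the cost of
  an epoch.\<close>

lemma sarah_inner_reach:
  assumes x: "reach n d x0 r x"
  shows "(u, w, v) \<in> set_pmf (sarah_inner d n f \<eta> x t) \<Longrightarrow>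
    \<exists>r1 r2. reach n d x0 r1 u \<and> reach n d x0 r2 w \<and> reach n d (\<lambda>_. 0) r2 v \<and> (\<forall>b. r1 b \<le> r2 b)
      \<and> sum r1 {..<n} \<le> sum r {..<n} + n + (t - 1) \<and> sum r2 {..<n} \<le> sum r {..<n} + n + t"
proof (induction t arbitrary: u w v)
  case 0
  let ?r = "\<lambda>b. Suc (r b)"
  from 0 have [simp]: "u = x" "w = (\<lambda>j. x j - \<eta> * grad d (avg n f) x j)" "v = grad d (avg n f) x"
    by (auto simp: Let_def)
  have "reach n d (\<lambda>_. 0) ?r v" using full[OF x] by simp
  moreover from this have "reach n d x0 ?r w"
    using reach_diff_scale[OF reach_mono[OF x], of ?r] by simp
  ultimately show ?case using x
    by (intro exI[of _ r] exI[of _ ?r]) (simp add: sum_Suc)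
next
  case (Suc t)
  from Suc.prems obtain u' v' i where
    prev: "(u', u, v') \<in> set_pmf (sarah_inner d n f \<eta> x t)" and i: "i \<in> {1..n}"
    \<comment> \<open>The division by 1 gives the difference the form of
      \<open>reach_zero_diff\<close>.\<close>
    and v: "v = (\<lambda>j. (grad d (f i) u j - grad d (f i) u' j) / 1 + v' j)"
    and w: "w = (\<lambda>j. u j - \<eta> * v j)"
    using n_pos by (auto simp: Let_def set_pmf_of_set split: prod.splits)
  from Suc.IH[OF prev] obtain r1 r2 where r: "reach n d x0 r1 u'" "reach n d x0 r2 u"
    "reach n d (\<lambda>_. 0) r2 v'" "\<And>b. r1 b \<le> r2 b" "sum r2 {..<n} \<le> sum r {..<n} + n + t"
    by blast
  let ?r = "advance n i r2"
  have "reach n d (\<lambda>_. 0) ?r (grad d (f i) u')"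
    by (rule reach_mono[OF component[OF r(1) i]] advance_mono r(4))+
  with component[OF r(2) i] have v0: "reach n d (\<lambda>_. 0) ?r v"
    unfolding v by (intro reach_zero_add reach_zero_diff reach_mono[OF r(3)] advance_ge)
  have "reach n d x0 ?r w"
    unfolding w by (intro reach_diff_scale v0 reach_mono[OF r(2)] advance_ge)
  with v0 r show ?case
    by (intro exI[of _ r2] exI[of _ ?r]) (simp add: sum_advance n_pos advance_ge)
qed

lemma sarah_reach:
  shows "reach n d x0 r x \<Longrightarrow> y \<in> set_pmf (sarah d n f \<eta> m k x K) \<Longrightarrow>
    \<exists>r'. reach n d x0 r' y \<and> sum r' {..<n} \<le> sum r {..<n} + K"
proof (induction K arbitrary: r x k rule: less_induct)
  case (less K)
  let ?c = "n + 2 * (m k - 1)"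
  show ?case
  proof (cases "K < ?c")
    case True
    with less.prems have "y = x" by (subst (asm) sarah.simps) auto
    with less.prems(1) show ?thesis by auto
  next
    case False
    with less.prems(2) n_pos obtain T z w v where T: "T \<le> m k"
      and z: "(z, w, v) \<in> set_pmf (sarah_inner d n f (\<eta> k) x T)"
      and y: "y \<in> set_pmf (sarah d n f \<eta> m (Suc k) z (K - ?c))"
      by (subst (asm) sarah.simps) (auto simp: set_pmf_of_set split: prod.splits)
    from sarah_inner_reach[OF less.prems(1) z] obtain r1 where r1: "reach n d x0 r1 z"
      "sum r1 {..<n} \<le> sum r {..<n} + n + (T - 1)" by blast
    moreover have "K - ?c < K" using False n_pos by simp
    from less.IH[OF this r1(1) y] obtain r2 where
      "reach n d x0 r2 y" "sum r2 {..<n} \<le> sum r1 {..<n} + (K - ?c)" by auto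
    ultimately show ?thesis using T False by (intro exI[of _ r2]) auto
  qed
qed

end

section \<open>Expectations over runs\<close>

lemma finite_set_svrg_inner:
  "finite (set_pmf p) \<Longrightarrow> finite (set_pmf (svrg_inner d n f p \<eta> w0 t w))"
  by (induction t arbitrary: w) (auto simp: Let_def)

text \<open>The geometric length is unbounded, but all lengths beyond the budget give the same point
  \<open>x\<close>. Finite support makes every expectation below well behaved.\<close>

lemma finite_set_svrg:
  assumes p: "finite (set_pmf p)" and n: "0 < n"
  shows "finite (set_pmf (svrg d n f p \<eta> m k x K))"
proof (induction K arbitrary: x k rule: less_induct)
  case (less K)
  let ?S = "insert x (\<Union>N\<in>{N. N \<le> K \<and> n + 2 * N \<le> K}. \<Union>y\<in>set_pmf (svrg_inner d n f p (\<eta> k) x N x).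
     set_pmf (svrg d n f p \<eta> m (Suc k) y (K - (n + 2 * N))))"
  have "finite ?S" using n by (auto intro!: less.IH finite_set_svrg_inner p)
  moreover have "set_pmf (svrg d n f p \<eta> m k x K) \<subseteq> ?S"
    using n by (subst svrg.simps) (auto split: if_splits simp: not_less)
  ultimately show ?case by (rule finite_subset[rotated])
qed

lemma finite_set_sarah_inner: "0 < n \<Longrightarrow> finite (set_pmf (sarah_inner d n f \<eta> x t))"
  by (induction t) (auto simp: Let_def set_pmf_of_set split: prod.splits)

lemma finite_set_sarah:
  assumes n: "0 < n"
  shows "finite (set_pmf (sarah d n f \<eta> m k x K))"
proof (induction K arbitrary: x k rule: less_induct)
  case (less K)
  then show ?case
    using n by (subst sarah.simps) (auto simp: set_pmf_of_set finite_set_sarah_inner split: prod.splits)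
qed

lemma expectation_ge_const:
  fixes g :: "'a \<Rightarrow> real"
  assumes "finite (set_pmf M)" "\<And>y. y \<in> set_pmf M \<Longrightarrow> c \<le> g y"
  shows "c \<le> measure_pmf.expectation M g"
  using assms by (intro measure_pmf.integral_ge_const integrable_measure_pmf_finite) (auto simp: AE_measure_pmf_iff)

lemma expectation_ge_pmf:
  fixes g :: "'a \<Rightarrow> real"
  assumes "finite (set_pmf M)" "\<And>y. 0 \<le> g y"
  shows "pmf M x * g x \<le> measure_pmf.expectation M g"
proof -
  have "pmf M x * g x = measure_pmf.expectation M (\<lambda>y. indicator {x} y * g x)"
    by (simp add: measure_pmf_single)
  also have "\<dots> \<le> measure_pmf.expectation M g"
    using assms by (intro integral_mono integrable_measure_pmf_finite) (auto simp: indicator_def)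
  finally show ?thesis .
qed

section \<open>Probability that a run ends where it started\<close>

lemma geometric_pmf_tail:
  assumes "0 < q" "q \<le> 1"
  shows "measure (measure_pmf (geometric_pmf q)) {M<..} = (1 - q) ^ Suc M"
proof -
  have "measure (measure_pmf (geometric_pmf q)) {..M} = (\<Sum>i\<le>M. (1 - q) ^ i * q)"
    using assms by (simp add: measure_measure_pmf_finite)
  also have "\<dots> = 1 - (1 - q) ^ Suc M"
    by (simp only: one_diff_power_eq[of "1 - q" "Suc M"] lessThan_Suc_atMost sum_distrib_left)
      (simp add: mult.commute)
  finally have "measure (measure_pmf (geometric_pmf q)) {..M} = 1 - (1 - q) ^ Suc M" .
  moreover have "- {..M} = {M<..}" by auto
  ultimately show ?thesis using measure_pmf.prob_compl[of "{..M}" "geometric_pmf q"]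
    by (simp add: Compl_eq_Diff_UNIV)
qed

text \<open>
  An epoch without inner steps costs \<open>n\<close> and does not move. If it has probability \<open>q\<close> below
  \<open>exp (- C * n)\<close>, the mean length \<open>1 / q - 1\<close> is so large that a single epoch exceeds the budget with
  probability at least \<open>exp (- C * K)\<close>.
\<close>

lemma svrg_stays:
  assumes n: "0 < n" and m: "\<And>k. 0 \<le> m k"
    and C: "exp (- C * real n) \<le> C / 2" "exp (- C * real n) \<le> 1 / 2"
  shows "exp (- C * real K) \<le> pmf (svrg d n f p \<eta> m k x K) x"
proof (induction K arbitrary: k rule: less_induct)
  case (less K)
  have C0: "0 \<le> C" using C(1) exp_ge_zero[of "- C * real n"] by linarith
  define q where "q = 1 / (m k + 1)"
  have q: "0 < q" "q \<le> 1" using m[of k] by (auto simp: q_def)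
  show ?case
  proof (cases "K < n")
    case True
    then have "svrg d n f p \<eta> m k x K = return_pmf x"
      by (subst svrg.simps) simp
    then show ?thesis using C0 by simp
  next
    case False
    \<comment> \<open>The largest number of inner steps that fits into the budget.\<close>
    define M where "M = (K - n) div 2"
    define body where "body N = (if K < n + 2 * N then return_pmf x
        else do {y \<leftarrow> svrg_inner d n f p (\<eta> k) x N x; svrg d n f p \<eta> m (Suc k) y (K - (n + 2 * N))})" for N
    let ?e = "exp (- C * real (K - n))"
    have IH: "?e \<le> pmf (body 0) x"
      using False less.IH[of "K - n" "Suc k"] n by (simp add: body_def bind_return_pmf)
    \<comment> \<open>Two disjoint events are kept: the epoch is too long, or it has no inner steps
      and the remaining run stays.\<close>
    have body: "indicator {M<..} N + indicator {0} N * ?e \<le> pmf (body N) x" for N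
    proof (cases "M < N")
      case True
      then have "K < n + 2 * N" "N \<noteq> 0" by (auto simp: M_def)
      then show ?thesis using True by (simp add: body_def)
    qed (use IH in \<open>auto simp: indicator_def\<close>)
    have ind: "integrable (geometric_pmf q) (indicator A :: nat \<Rightarrow> real)" for A
      by (intro measure_pmf.integrable_const_bound[where B = 1]) auto
    have "(1 - q) ^ Suc M + q * ?e =
        measure_pmf.expectation (geometric_pmf q) (\<lambda>N. indicator {M<..} N + indicator {0} N * ?e)"
      using q by (simp add: ind geometric_pmf_tail measure_pmf_single)
    also have "\<dots> \<le> measure_pmf.expectation (geometric_pmf q) (\<lambda>N. pmf (body N) x)"
      by (intro integral_mono body measure_pmf.integrable_const_bound[where B = 1]
          Bochner_Integration.integrable_add integrable_mult_left ind) (auto simp: pmf_le_1)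
    also have "\<dots> = pmf (svrg d n f p \<eta> m k x K) x"
      using n by (subst svrg.simps) (simp add: pmf_bind body_def q_def cong: if_cong)
    finally have ge: "(1 - q) ^ Suc M + q * ?e \<le> pmf (svrg d n f p \<eta> m k x K) x" .
    have "exp (- C * real K) \<le> (1 - q) ^ Suc M + q * ?e"
    proof (cases "exp (- C * real n) \<le> q")
      case True
      have "exp (- C * real K) = exp (- C * real n) * ?e"
        using False by (simp add: of_nat_diff algebra_simps flip: exp_add)
      also have "\<dots> \<le> q * ?e" using True by (intro mult_right_mono) auto
      also have "\<dots> \<le> (1 - q) ^ Suc M + q * ?e" using q by simp
      finally show ?thesis .
    next
      case False
      then have qC: "2 * q \<le> C" "q \<le> 1 / 2" using C by auto
      \<comment> \<open>Hence \<open>q + 2 * q^2 \<le> 2 * q \<le> C\<close>, which the logarithm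
        bound turns into \<open>exp (- C) \<le> 1 - q\<close>.\<close>
      have "q * q \<le> q * (1 / 2)" using q qC by (intro mult_left_mono) auto
      then have "- C \<le> ln (1 - q)"
        using ln_one_minus_pos_lower_bound[of q] q qC unfolding power2_eq_square by linarith
      then have "exp (- C) \<le> 1 - q" using qC by (simp add: ln_ge_iff)
      have "exp (- C * real K) = exp (- C) ^ K" by (simp flip: exp_of_nat_mult add: mult.commute)
      also have "\<dots> \<le> (1 - q) ^ K" by (intro power_mono \<open>exp (- C) \<le> 1 - q\<close>) auto
      also have "\<dots> \<le> (1 - q) ^ Suc M"
        using q n \<open>\<not> K < n\<close> by (intro power_decreasing) (auto simp: M_def)
      also have "\<dots> \<le> (1 - q) ^ Suc M + q * ?e" using q by simp
      finally show ?thesis .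
    qed
    with ge show ?thesis by linarith
  qed
qed

text \<open>The draw \<open>T = 0\<close> returns the start of the epoch. The condition on
  \<open>C\<close> says that its probability is at least the decay allowed for the cost of the
  epoch, for every possible length \<open>j\<close>.\<close>

lemma sarah_stays:
  assumes n: "0 < n" and C: "\<And>j. exp (- C * real (n + 2 * (j - 1))) \<le> 1 / (real j + 1)" "0 \<le> C"
  shows "exp (- C * real K) \<le> pmf (sarah d n f \<eta> m k x K) x"
proof (induction K arbitrary: k rule: less_induct)
  case (less K)
  let ?c = "n + 2 * (m k - 1)"
  show ?case
  proof (cases "K < ?c")
    case True
    then have "sarah d n f \<eta> m k x K = return_pmf x"
      by (subst sarah.simps) simp
    then show ?thesis using C by simp
  next
    case False
    define body where "body T = do {(y, _, _) \<leftarrow> sarah_inner d n f (\<eta> k) x T;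
        sarah d n f \<eta> m (Suc k) y (K - ?c)}" for T
    have IH: "exp (- C * real (K - ?c)) \<le> pmf (body 0) x"
      using False less.IH[of "K - ?c" "Suc k"] n by (simp add: body_def bind_return_pmf Let_def)
    have "exp (- C * real K) = exp (- C * real ?c) * exp (- C * real (K - ?c))"
      using False by (subst of_nat_diff) (simp_all add: algebra_simps flip: exp_add)
    also have "\<dots> \<le> 1 / (real (m k) + 1) * pmf (body 0) x"
      using C(1)[of "m k"] IH by (intro mult_mono) auto
    also have "\<dots> = pmf (pmf_of_set {0..m k}) 0 * pmf (body 0) x" by (simp add: add.commute)
    also have "\<dots> \<le> measure_pmf.expectation (pmf_of_set {0..m k}) (\<lambda>T. pmf (body T) x)"
      by (intro expectation_ge_pmf) (auto simp: set_pmf_of_set)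
    also have "\<dots> = pmf (sarah d n f \<eta> m k x K) x"
      using n False by (subst sarah.simps) (simp add: pmf_bind body_def cong: if_cong)
    finally show ?thesis .
  qed
qed

section \<open>Hard instances\<close>

text \<open>The dimension precedes the start, and the instance precedes the budget and all
  parameters, so one instance is hard for every budget in \<open>P\<close> and both algorithms. The
  budget set and the bound are parameters in order to pass from an exponential curve to the constant
  \<open>\<epsilon>\<close>.\<close>

definition lower_bound ::
  "nat \<Rightarrow> real \<Rightarrow> real \<Rightarrow> real \<Rightarrow> (nat \<Rightarrow> bool) \<Rightarrow> (nat \<Rightarrow> real) \<Rightarrow> bool" where
  "lower_bound n L \<mu> \<Delta> P lb \<longleftrightarrow> (\<exists>d. \<forall>x0\<in>Rn d. \<exists>(f :: nat \<Rightarrow> point \<Rightarrow> real) xs.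
     (\<forall>i\<in>{1..n}. L_smooth d L (f i) \<and> strongly_convex d \<mu> (f i)) \<and>
     is_arg_min (avg n f) (\<lambda>x. x \<in> Rn d) xs \<and>
     avg n f x0 - avg n f xs = \<Delta> \<and>
     (\<forall>K. P K \<longrightarrow>
        (\<forall>p \<eta> m. set_pmf p \<subseteq> {1..n} \<and> (\<forall>k. 0 \<le> m k) \<longrightarrow>
           lb K \<le> measure_pmf.expectation (svrg d n f p \<eta> m 0 x0 K) (\<lambda>x. avg n f x - avg n f xs)) \<and>
        (\<forall>\<eta> m.
           lb K \<le> measure_pmf.expectation (sarah d n f \<eta> m 0 x0 K) (\<lambda>x. avg n f x - avg n f xs))))"

lemma lower_bound_mono:
  assumes "lower_bound n L \<mu> \<Delta> P lb" and mono: "\<And>K. P' K \<Longrightarrow> P K \<and> lb' K \<le> lb K"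
  shows "lower_bound n L \<mu> \<Delta> P' lb'"
proof -
  from assms(1) obtain d where d: "\<And>x0. x0 \<in> Rn d \<Longrightarrow> \<exists>(f :: nat \<Rightarrow> point \<Rightarrow> real) xs.
     (\<forall>i\<in>{1..n}. L_smooth d L (f i) \<and> strongly_convex d \<mu> (f i)) \<and>
     is_arg_min (avg n f) (\<lambda>x. x \<in> Rn d) xs \<and>
     avg n f x0 - avg n f xs = \<Delta> \<and>
     (\<forall>K. P K \<longrightarrow>
        (\<forall>p \<eta> m. set_pmf p \<subseteq> {1..n} \<and> (\<forall>k. 0 \<le> m k) \<longrightarrow>
           lb K \<le> measure_pmf.expectation (svrg d n f p \<eta> m 0 x0 K) (\<lambda>x. avg n f x - avg n f xs)) \<and>
        (\<forall>\<eta> m.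
           lb K \<le> measure_pmf.expectation (sarah d n f \<eta> m 0 x0 K) (\<lambda>x. avg n f x - avg n f xs)))"
    unfolding lower_bound_def by (elim exE) (rule that, erule bspec)
  show ?thesis
    unfolding lower_bound_def
    by (intro exI[of _ d] ballI, drule d, elim exE conjE, intro exI conjI, assumption+)
      (intro allI impI conjI; meson mono order_trans)
qed

text \<open>The dimension may grow with the cap \<open>M\<close>, but \<open>\<delta>\<close> may
  not: the threshold for \<open>\<epsilon>\<close> is fixed before the cap.\<close>

definition slow :: "nat \<Rightarrow> real \<Rightarrow> real \<Rightarrow> real \<Rightarrow> real \<Rightarrow> bool" where
  "slow n L \<mu> \<Delta> B \<longleftrightarrow>
     (\<exists>\<delta>>0. \<forall>M. lower_bound n L \<mu> \<Delta> (\<lambda>K. K \<le> M) (\<lambda>K. \<delta> * exp (- B * real K)))"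

text \<open>All components are the same one-dimensional parabola, and a run that stays at
  \<open>x0\<close> keeps the whole gap. The exponent satisfies \<open>C * n = 2 + 2 * ln n\<close>,
  enough for the hypotheses of both staying lemmas.\<close>

lemma slow_well_conditioned:
  assumes n: "1 \<le> n" and \<mu>: "0 < \<mu>" "\<mu> \<le> L" and \<Delta>: "0 < \<Delta>"
  shows "slow n L \<mu> \<Delta> (2 * (1 + ln (real n)) / real n)"
proof -
  define C where "C = 2 * (1 + ln (real n)) / real n"
  have n0: "0 < real n" "1 \<le> real n" and ln0: "0 \<le> ln (real n)" using n by auto
  have C0: "0 \<le> C" using n0 ln0 by (simp add: C_def)
  have Cn: "C * real n = 2 + 2 * ln (real n)" using n0 by (simp add: C_def)
  have "exp (- C * real n) = exp (- 2) * exp (- ln (real n)) * exp (- ln (real n))"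
    unfolding mult_minus_left Cn by (simp flip: exp_add)
  also have "\<dots> = exp (- 2) * (1 / real n) * (1 / real n)" using n0 by (simp add: exp_minus inverse_eq_divide)
  also have "\<dots> \<le> (1 / 2) * 1 * (1 / real n)"
    using exp_ge_add_one_self[of 2] n0 by (intro mult_mono) (auto simp: exp_minus field_simps)
  finally have e: "exp (- C * real n) \<le> 1 / (2 * real n)" by simp
  have C1: "exp (- C * real n) \<le> C / 2" by (rule order_trans[OF e]) (use n0 ln0 in \<open>simp add: C_def field_simps\<close>)
  have C2: "exp (- C * real n) \<le> 1 / 2" by (rule order_trans[OF e]) (use n0 in \<open>simp add: field_simps\<close>)
  have C3: "exp (- C * real (n + 2 * (j - 1))) \<le> 1 / (real j + 1)" for j
  proof -
    have "ln (real j + 1) \<le> C * real (n + 2 * (j - 1))"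
    proof (cases "j \<le> n")
      case True
      have "ln (real j + 1) \<le> ln (2 * real n)" using True n0 by (subst ln_le_cancel_iff) auto
      also have "\<dots> \<le> 1 + ln (real n)" using n0 ln_2_less_1 by (simp add: ln_mult)
      also have "\<dots> \<le> C * real n" unfolding Cn using ln0 by simp
      also have "\<dots> \<le> C * real (n + 2 * (j - 1))" using C0 by (intro mult_left_mono) auto
      finally show ?thesis .
    next
      case False
      then have j: "real n \<le> real j" "1 \<le> real j" using n by auto
      \<comment> \<open>Splitting off \<open>ln (j / n) \<le> j / n - 1\<close> lets the linear cost
        of a long epoch absorb the logarithm.\<close>
      have "ln (real j + 1) \<le> ln (2 * real n * (real j / real n))"
        using n0 j by (subst ln_le_cancel_iff) auto
      also have "\<dots> = ln 2 + ln (real n) + ln (real j / real n)" using n0 j by (simp add: ln_mult ln_div)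
      also have "\<dots> \<le> 1 + ln (real n) + (real j / real n - 1)"
        using ln_2_less_1 n0 j by (intro add_mono ln_le_minus_one) auto
      also have "\<dots> \<le> (1 + ln (real n)) * (real j / real n) + (1 + ln (real n)) * (real j / real n)"
      proof -
        have "1 \<le> real j / real n" using n0 j by (simp add: field_simps)
        then have "ln (real n) * 1 \<le> ln (real n) * (real j / real n)" "0 \<le> real j / real n"
          using ln0 by (intro mult_left_mono, auto)
        then show ?thesis using ln0 unfolding distrib_right by linarith
      qed
      also have "\<dots> = C * real j" by (simp add: C_def)
      also have "\<dots> \<le> C * real (n + 2 * (j - 1))" using C0 False n by (intro mult_left_mono) auto
      finally show ?thesis .
    qed
    then have "exp (- C * real (n + 2 * (j - 1))) \<le> exp (- ln (real j + 1))" by simp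
    also have "\<dots> = 1 / (real j + 1)" by (simp add: exp_minus inverse_eq_divide)
    finally show ?thesis .
  qed
  have "lower_bound n L \<mu> \<Delta> (\<lambda>K. K \<le> M) (\<lambda>K. \<Delta> * exp (- C * real K))" for M
    unfolding lower_bound_def
  proof (intro exI[of _ 1] ballI)
    fix x0 assume x0: "x0 \<in> Rn 1"
    \<comment> \<open>The distance at which a parabola of curvature \<open>\<mu>\<close> has gap
      \<open>\<Delta>\<close>.\<close>
    define xs :: point where "xs = (\<lambda>j. if j = 0 then x0 0 - sqrt (2 * \<Delta> / \<mu>) else 0)"
    define g where "g = (\<lambda>x :: point. \<mu> / 2 * (x 0 - xs 0)\<^sup>2)"
    define f where "f = (\<lambda>i :: nat. g)"
    have avg: "avg n f = g" using n by (intro ext) (simp add: avg_def f_def)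
    have L2: "L2_set h {..<1} = \<bar>h 0\<bar>" for h :: point by (simp add: L2_set_def lessThan_Suc)
    interpret quadratic 1 g "\<lambda>x j. if j = 0 then \<mu> * (x 0 - xs 0) else 0" "\<lambda>h. \<mu> / 2 * (h 0)\<^sup>2" L \<mu>
    proof
      fix x y :: point
      have "\<bar>\<mu> * (x 0 - y 0)\<bar> \<le> L * \<bar>x 0 - y 0\<bar>" using \<mu> by (simp add: abs_mult mult_right_mono)
      then show "L2_set (\<lambda>j :: nat. (if j = 0 then \<mu> * (x 0 - xs 0) else 0)
          - (if j = 0 then \<mu> * (y 0 - xs 0) else 0)) {..<1} \<le> L * L2_set (\<lambda>j. x j - y j) {..<1}"
        unfolding L2 by (simp add: algebra_simps)
    qed (use \<mu> in \<open>auto simp: Rn_def g_def L2 lessThan_Suc power2_eq_square algebra_simps\<close>)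
    have min: "is_arg_min (avg n f) (\<lambda>x. x \<in> Rn 1) xs"
      unfolding avg by (rule is_arg_min_stationary) (auto simp: Rn_def xs_def)
    have gap: "avg n f x0 - avg n f xs = \<Delta>" unfolding avg using \<mu> \<Delta> by (simp add: g_def xs_def)
    have nonneg: "0 \<le> avg n f y - avg n f xs" for y unfolding avg using \<mu> by (simp add: g_def)
    have ge: "\<Delta> * exp (- C * real K) \<le> measure_pmf.expectation P (\<lambda>x. avg n f x - avg n f xs)"
      if "finite (set_pmf P)" "exp (- C * real K) \<le> pmf P x0" for P K
    proof -
      have "\<Delta> * exp (- C * real K) \<le> pmf P x0 * (avg n f x0 - avg n f xs)"
        using that \<Delta> unfolding gap by (simp add: mult.commute)
      also have "\<dots> \<le> measure_pmf.expectation P (\<lambda>x. avg n f x - avg n f xs)"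
        using that nonneg by (intro expectation_ge_pmf)
      finally show ?thesis .
    qed
    have svrg: "\<Delta> * exp (- C * real K)
        \<le> measure_pmf.expectation (svrg 1 n f p \<eta> m 0 x0 K) (\<lambda>x. avg n f x - avg n f xs)"
      if "set_pmf p \<subseteq> {1..n}" "\<forall>k. 0 \<le> m k" for p \<eta> m K
      using that n finite_subset[OF that(1)]
      by (intro ge finite_set_svrg svrg_stays C1 C2) auto
    have sarah: "\<Delta> * exp (- C * real K)
        \<le> measure_pmf.expectation (sarah 1 n f \<eta> m 0 x0 K) (\<lambda>x. avg n f x - avg n f xs)" for \<eta> m K
      using n by (intro ge finite_set_sarah sarah_stays C3 C0) auto
    show "\<exists>f xs. (\<forall>i\<in>{1..n}. L_smooth 1 L (f i) \<and> strongly_convex 1 \<mu> (f i)) \<and>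
     is_arg_min (avg n f) (\<lambda>x. x \<in> Rn 1) xs \<and>
     avg n f x0 - avg n f xs = \<Delta> \<and>
     (\<forall>K\<le>M.
        (\<forall>p \<eta> m. set_pmf p \<subseteq> {1..n} \<and> (\<forall>k. 0 \<le> m k) \<longrightarrow>
           \<Delta> * exp (- C * real K)
             \<le> measure_pmf.expectation (svrg 1 n f p \<eta> m 0 x0 K) (\<lambda>x. avg n f x - avg n f xs)) \<and>
        (\<forall>\<eta> m. \<Delta> * exp (- C * real K)
           \<le> measure_pmf.expectation (sarah 1 n f \<eta> m 0 x0 K) (\<lambda>x. avg n f x - avg n f xs)))"
      using min gap svrg sarah L_smooth strongly_convex
      by (intro exI[of _ f] exI[of _ xs]) (simp add: f_def)
  qed
  then show ?thesis unfolding slow_def C_def[symmetric] using \<Delta> by blast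
qed

section \<open>Average and sparsity of the chain functions\<close>

lemma sum_mod_indicator:
  fixes n b :: nat
  assumes "0 < n" "b < n"
  shows "(\<Sum>i=1..n. if b = i mod n then a else 0) = (a :: real)"
proof -
  have "i mod n = (if i = n then 0 else i)" if "i \<in> {1..n}" for i using that by auto
  then have "{i \<in> {1..n}. b = i mod n} = {if b = 0 then n else b}"
    using assms by (auto split: if_splits)
  then show ?thesis by (simp flip: sum.inter_filter)
qed

text \<open>A chain function is affine in its weight, so averaging the functions averages the
  weights.\<close>

lemma avg_chain:
  assumes "\<And>k. (\<Sum>i=1..n. e i k) = a" "0 < n"
  shows "avg n (\<lambda>i x. chain n d \<mu> \<gamma> s (e i) (g x)) = (\<lambda>x. chain n d \<mu> \<gamma> s (\<lambda>_. a / real n) (g x))"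
proof
  fix x
  let ?c = "\<lambda>k. ((chain_diff n s (g x) k)\<^sup>2 + (if k + n < d then 0 else \<gamma> * (g x k)\<^sup>2)) / 2"
  have "(\<Sum>i=1..n. chain n d \<mu> \<gamma> s (e i) (g x)) = (\<Sum>i=1..n. \<Sum>k<d. e i k * ?c k + \<mu> / 2 * (g x k)\<^sup>2)"
    by (simp add: chain_def)
  also have "\<dots> = (\<Sum>k<d. \<Sum>i=1..n. e i k * ?c k + \<mu> / 2 * (g x k)\<^sup>2)"
    by (rule sum.swap)
  also have "\<dots> = (\<Sum>k<d. a * ?c k + real n * (\<mu> / 2 * (g x k)\<^sup>2))"
    unfolding sum.distrib sum_distrib_right[symmetric] assms(1) by (simp add: mult.assoc)
  finally have "(\<Sum>i=1..n. chain n d \<mu> \<gamma> s (e i) (g x)) = \<dots>" .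
  then show "avg n (\<lambda>i x. chain n d \<mu> \<gamma> s (e i) (g x)) x = chain n d \<mu> \<gamma> s (\<lambda>_. a / real n) (g x)"
    unfolding avg_def using assms(2)
    by (simp only: sum_divide_distrib chain_def[of n d \<mu> \<gamma> s "\<lambda>_. a / real n"])
      (intro sum.cong refl, simp add: field_simps)
qed

text \<open>A gradient coordinate sees only its two neighbours, and with weight 0 only itself.
  Beyond the advanced front, the predecessor is also untouched and the driving value
  \<open>s\<close> is out of sight.\<close>

lemma reach_chain_grad:
  assumes x: "reach n d z r x" and n: "0 < n" and le: "\<And>b. r b \<le> r' b"
    and e: "\<And>k. e k \<noteq> 0 \<Longrightarrow> Suc (r (k mod n)) \<le> r' (k mod n)"
  shows "reach n d (\<lambda>_. 0) r' (chain_grad n d \<mu> \<gamma> s e (\<lambda>j. x j - z j))"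
  unfolding reach_def
proof (intro conjI allI impI)
  show "chain_grad n d \<mu> \<gamma> s e (\<lambda>j. x j - z j) \<in> Rn d" by (simp add: Rn_def chain_grad_def)
  fix k assume k: "r' (k mod n) \<le> k div n"
  have eq: "x j = z j" if "r (j mod n) \<le> j div n" for j using x that by (simp add: reach_def)
  have xk: "x k = z k" using k le order_trans by (intro eq) blast
  show "chain_grad n d \<mu> \<gamma> s e (\<lambda>j. x j - z j) k = 0"
  proof (cases "e k = 0")
    case True
    then show ?thesis by (simp add: chain_grad_def xk)
  next
    case False
    with e k have k1: "Suc (r (k mod n)) \<le> k div n" using order_trans by blast
    then have "\<not> k < n" by auto
    then obtain j where j: "k = j + n" using le_Suc_ex[of n k] by (auto simp: add.commute)
    have "x (k + n) = z (k + n)" "x (k - n) = z (k - n)"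
      using k1 n by (auto intro!: eq simp: j)
    then show ?thesis using \<open>\<not> k < n\<close> by (simp add: chain_grad_def chain_diff_def xk)
  qed
qed

lemma pigeonhole_div:
  assumes "sum r {..<n} \<le> K" "0 < n"
  shows "\<exists>b<n. r b \<le> K div (n :: nat)"
proof (rule ccontr)
  assume "\<not> ?thesis"
  then have "(\<Sum>b<n. Suc (K div n)) \<le> sum r {..<n}" by (intro sum_mono) (auto simp: not_le)
  also have "\<dots> \<le> K" by fact
  finally have "n + n * (K div n) \<le> K" by simp
  moreover have "K < n + n * (K div n)" using assms(2)
    by (metis add.commute dividend_less_times_div mult.commute)
  ultimately show False by simp
qed

text \<open>
  \<open>q = exp (- 2 * u)\<close> with \<open>sinh u\<^sup>2 = n / (L / \<mu> - 1)\<close> is the decay rate of the minimizer along the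
  chains: \<open>(1 - q)\<^sup>2 / q = 4 * sinh u\<^sup>2\<close>. The boundary weight \<open>\<gamma> = 1 - q\<close> makes the minimizer of the
  finite chain exactly geometric.
\<close>

lemma slow_chain:
  assumes n: "1 \<le> n" and \<mu>: "0 < \<mu>" "\<mu> < L" and \<Delta>: "0 < \<Delta>"
  shows "slow n L \<mu> \<Delta> (4 * arsinh (sqrt (real n / (L / \<mu> - 1))) / real n)"
proof -
  define u where "u = arsinh (sqrt (real n / (L / \<mu> - 1)))"
  define q where "q = exp (- 2 * u)"
  \<comment> \<open>\<open>a\<close> makes the smoothness constant \<open>4 * a + \<mu>\<close>
    equal to \<open>L\<close>, and \<open>s\<close> makes the gap \<open>a * q * s^2 / 2\<close>
    equal to \<open>\<Delta>\<close>.\<close>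
  define a where "a = (L - \<mu>) / 4"
  define s where "s = sqrt (2 * \<Delta> / (a * q))"
  define \<delta> where "\<delta> = \<mu> / 2 * (s\<^sup>2 * q\<^sup>2)"
  have n0: "0 < n" "0 < real n" using n by auto
  have \<rho>: "0 < real n / (L / \<mu> - 1)" using n0 \<mu> by simp
  have u: "0 < u" "(sinh u)\<^sup>2 = real n / (L / \<mu> - 1)"
    using \<rho> by (auto simp: u_def simp del: zero_less_divide_iff)
  have q: "0 < q" "q < 1" using u by (auto simp: q_def)
  have a: "0 < a" using \<mu> by (simp add: a_def)
  have s: "s\<^sup>2 = 2 * \<Delta> / (a * q)" "0 < s" using a q \<Delta> by (auto simp: s_def)
  \<comment> \<open>The characteristic equation of the chain: a geometric sequence with ratio
    \<open>q\<close> is stationary for the average.\<close>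
  have rate: "a * (1 - q)\<^sup>2 = real n * \<mu> * q"
  proof -
    have "exp (- u) * exp u = 1" "exp (- u) * exp (- u) = q"
      by (simp_all add: q_def flip: exp_add)
    then have "exp (- u) * (2 * sinh u) = 1 - q"
      by (simp add: sinh_field_def right_diff_distrib)
    then have "(1 - q)\<^sup>2 = (exp (- u) * (2 * sinh u))\<^sup>2" by simp
    also have "\<dots> = (exp (- u))\<^sup>2 * (4 * (sinh u)\<^sup>2)" by (simp add: power_mult_distrib)
    also have "(exp (- u))\<^sup>2 = q" by (simp add: q_def flip: exp_double)
    finally have "(1 - q)\<^sup>2 = q * (4 * (real n / (L / \<mu> - 1)))" by (simp add: u)
    moreover have "L / \<mu> - 1 = 4 * a / \<mu>" using \<mu> by (simp add: a_def field_simps)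
    ultimately show ?thesis using a \<mu> by (simp add: field_simps)
  qed
  have \<delta>: "0 < \<delta>" using \<mu>(1) s(2) q unfolding \<delta>_def by (intro mult_pos_pos zero_less_power) auto
  have "lower_bound n L \<mu> \<Delta> (\<lambda>K. K \<le> M) (\<lambda>K. \<delta> * exp (- (4 * u / real n) * real K))" for M
    unfolding lower_bound_def
  \<comment> \<open>Each chain has one coordinate more than the \<open>M div n\<close> that the
    least explored chain can have seen.\<close>
  proof (intro exI[of _ "n * Suc (M div n)"] ballI)
    let ?d = "n * Suc (M div n)"
    fix x0 assume x0: "x0 \<in> Rn ?d"
    define e where "e i k = (if k mod n = i mod n then a else 0)" for i k
    define f where "f i x = chain n ?d \<mu> (1 - q) s (e i) (\<lambda>j. x j - x0 j)" for i x
    define h :: point where "h k = (if k < ?d then s * q ^ Suc (k div n) else 0)" for k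
    define xs where "xs = (\<lambda>k. x0 k + h k)"
    have h: "h \<in> Rn ?d" by (simp add: Rn_def h_def)
    have xs: "xs \<in> Rn ?d" unfolding xs_def by (rule Rn_add[OF x0 h])
    have L: "4 * a + \<mu> = L" by (simp add: a_def field_simps)
    have comp: "quadratic ?d (f i) (\<lambda>x. chain_grad n ?d \<mu> (1 - q) s (e i) (\<lambda>j. x j - x0 j))
        (chain n ?d \<mu> (1 - q) 0 (e i)) L \<mu>" for i
      using quadratic_chain[of "e i" a n "1 - q" \<mu> x0 ?d s] a q \<mu> n0 x0
      unfolding f_def[abs_def] L by (simp add: e_def)
    have "(\<Sum>i=1..n. e i k) = a" for k
      unfolding e_def using n0 by (intro sum_mod_indicator) auto
    then have avg: "avg n f = (\<lambda>x. chain n ?d \<mu> (1 - q) s (\<lambda>_. a / real n) (\<lambda>j. x j - x0 j))"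
      unfolding f_def[abs_def] using n0 by (intro avg_chain) auto
    define G where "G = chain_grad n ?d \<mu> (1 - q) s (\<lambda>_. a / real n)"
    define R where "R = chain n ?d \<mu> (1 - q) 0 (\<lambda>_. a / real n)"
    have "a / real n \<le> a" using a n0 by (simp add: field_simps)
    then interpret full: quadratic ?d "avg n f" "\<lambda>x. G (\<lambda>j. x j - x0 j)" R L \<mu>
      using quadratic_chain[of "\<lambda>_. a / real n" a n "1 - q" \<mu> x0 ?d s] a q \<mu> n0 x0
      unfolding avg L G_def R_def by simp
    interpret zero_chain n ?d x0 f
    proof
      fix r x i assume x: "reach n ?d x0 r x"
      then have xR: "x \<in> Rn ?d" by (rule reach_Rn)
      show "reach n ?d (\<lambda>_. 0) (advance n i r) (grad ?d (f i) x)"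
        unfolding quadratic.grad_eq[OF comp xR]
        by (rule reach_chain_grad[OF x n0(1)]) (auto simp: e_def advance_def split: if_splits)
      show "reach n ?d (\<lambda>_. 0) (\<lambda>b. Suc (r b)) (grad ?d (avg n f) x)"
        unfolding full.grad_eq[OF xR] G_def by (rule reach_chain_grad[OF x n0(1)]) auto
    qed (rule n0)
    have stationary: "G (\<lambda>j. xs j - x0 j) k = 0" if k: "k < ?d" for k
    proof -
      have D: "chain_diff n s h k = s * q ^ (k div n) * (q - 1)" if "k < ?d" for k
      proof (cases "k < n")
        case True
        then show ?thesis using that by (simp add: chain_diff_def h_def algebra_simps)
      next
        case False
        then obtain j where j: "k = j + n" using le_Suc_ex[of n k] by (auto simp: add.commute)
        with that have "j < ?d" by simp
        then show ?thesis using that n0 by (simp add: chain_diff_def h_def j algebra_simps)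
      qed
      \<comment> \<open>The boundary weight \<open>1 - q\<close> makes the end term agree with the
        interior formula, so one computation covers both.\<close>
      have "(if k + n < ?d then - chain_diff n s h (k + n) else (1 - q) * h k)
          = s * q ^ (k div n) * (q * (1 - q))"
        using D[of "k + n"] k n0 by (simp add: h_def algebra_simps del: mult_Suc_right)
      then have "G h k = a / real n * (s * q ^ (k div n) * (q - 1) + s * q ^ (k div n) * (q * (1 - q)))
          + \<mu> * (s * q ^ Suc (k div n))"
        unfolding G_def chain_grad_def using D[OF k] k by (simp add: h_def)
      also have "\<dots> = s * q ^ (k div n) * (\<mu> * q - a * (1 - q)\<^sup>2 / real n)"
        using n0 by (simp add: power2_eq_square field_simps)
      finally have "G h k = s * q ^ (k div n) * (\<mu> * q - a * (1 - q)\<^sup>2 / real n)" .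
      then show ?thesis using rate n0 by (simp add: xs_def)
    qed
    have gap: "avg n f x0 - avg n f xs = \<Delta>"
    proof -
      \<comment> \<open>Expanding from both ends and using that \<open>R\<close> is even eliminates
        \<open>R h\<close>. Twice the gap is then a linear term, supported on the first coordinate
        of each chain.\<close>
      have R: "R (\<lambda>j. - h j) = R h"
        unfolding R_def chain_def by (intro sum.cong refl) (simp add: chain_diff_def power2_commute)
      have "avg n f xs = avg n f x0 + (\<Sum>j<?d. G (\<lambda>_. 0) j * h j) + R h"
        using full.expansion[OF x0 h] by (simp add: xs_def)
      moreover have "avg n f x0 = avg n f xs + R h"
        using full.expansion[OF xs Rn_uminus[OF h]] stationary by (simp add: R) (simp add: xs_def)
      moreover have "(\<Sum>j<?d. G (\<lambda>_. 0) j * h j) = (\<Sum>j<n. - (a / real n * s * (s * q)))"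
        by (rule sum.mono_neutral_cong_right) (auto simp: G_def chain_grad_def chain_diff_def h_def)
      ultimately have "2 * (avg n f x0 - avg n f xs) = a * q * s\<^sup>2"
        using n0 by (simp add: power2_eq_square)
      then show ?thesis using a q by (simp add: s)
    qed
    have lower: "\<delta> * exp (- (4 * u / real n) * real K) \<le> avg n f y - avg n f xs"
      if K: "K \<le> M" and r: "reach n ?d x0 r y" "sum r {..<n} \<le> K" for K r y
    proof -
      from pigeonhole_div[OF r(2) n0(1)] obtain b where b: "b < n" "r b \<le> K div n" by auto
      \<comment> \<open>The first unexplored coordinate of the least explored chain; its error alone
        gives the bound, and \<open>q^2 = exp (- 4 * u)\<close> gives the rate.\<close>
      let ?k = "n * r b + b"
      have rK: "real (r b) \<le> real K / real n"
        using b(2) of_nat_div_le_of_nat[of K n] by (meson of_nat_mono order_trans)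
      have "r b \<le> M div n" using b(2) div_le_mono[OF K, of n] by simp
      then have "n * r b \<le> n * (M div n)" by (rule mult_le_mono2)
      then have k: "?k < ?d" using b(1) unfolding mult_Suc_right by linarith
      have y: "y ?k = x0 ?k" using r(1) b(1) by (simp add: reach_def)
      have "- (4 * u / real n) * real K = - 4 * u * (real K / real n)" by simp
      also have "\<dots> \<le> - 4 * u * real (r b)" using rK u by (intro mult_left_mono_neg) auto
      finally have "exp (- (4 * u / real n) * real K) \<le> exp (real (r b) * (- 4 * u))"
        by (simp add: mult.commute)
      also have "\<dots> = q ^ (2 * r b)"
        by (simp add: q_def algebra_simps flip: exp_of_nat_mult)
      finally have "\<delta> * exp (- (4 * u / real n) * real K) \<le> \<delta> * q ^ (2 * r b)"
        using \<delta> by (intro mult_left_mono) auto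
      also have "\<dots> = \<mu> / 2 * (y ?k - xs ?k)\<^sup>2"
        using k b(1) y by (simp add: \<delta>_def xs_def h_def power_mult_distrib power_mult power_commutes
            flip: power_even_eq)
      also have "\<dots> \<le> \<mu> / 2 * (L2_set (\<lambda>j. y j - xs j) {..<?d})\<^sup>2"
        unfolding L2_set_power2 using \<mu> k by (intro mult_left_mono member_le_sum) auto
      also have "\<dots> \<le> avg n f y - avg n f xs"
        using reach_Rn[OF r(1)] by (intro full.growth xs stationary)
      finally show ?thesis .
    qed
    have start: "reach n ?d x0 (\<lambda>_. 0) x0" using x0 by (simp add: reach_def)
    have svrg: "\<delta> * exp (- (4 * u / real n) * real K)
        \<le> measure_pmf.expectation (svrg ?d n f p \<eta> m 0 x0 K) (\<lambda>x. avg n f x - avg n f xs)"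
      if K: "K \<le> M" and p: "set_pmf p \<subseteq> {1..n}" for K p \<eta> m
    proof (rule expectation_ge_const)
      show "finite (set_pmf (svrg ?d n f p \<eta> m 0 x0 K))"
        using p finite_subset by (intro finite_set_svrg n0) blast
      show "\<delta> * exp (- (4 * u / real n) * real K) \<le> avg n f y - avg n f xs"
        if "y \<in> set_pmf (svrg ?d n f p \<eta> m 0 x0 K)" for y
        using svrg_reach[OF p start that] lower[OF K] by auto
    qed
    have sarah: "\<delta> * exp (- (4 * u / real n) * real K)
        \<le> measure_pmf.expectation (sarah ?d n f \<eta> m 0 x0 K) (\<lambda>x. avg n f x - avg n f xs)"
      if K: "K \<le> M" for K \<eta> m
    proof (rule expectation_ge_const)
      show "finite (set_pmf (sarah ?d n f \<eta> m 0 x0 K))" by (intro finite_set_sarah n0)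
      show "\<delta> * exp (- (4 * u / real n) * real K) \<le> avg n f y - avg n f xs"
        if "y \<in> set_pmf (sarah ?d n f \<eta> m 0 x0 K)" for y
        using sarah_reach[OF start that] lower[OF K] by auto
    qed
    show "\<exists>f xs. (\<forall>i\<in>{1..n}. L_smooth ?d L (f i) \<and> strongly_convex ?d \<mu> (f i)) \<and>
     is_arg_min (avg n f) (\<lambda>x. x \<in> Rn ?d) xs \<and>
     avg n f x0 - avg n f xs = \<Delta> \<and>
     (\<forall>K\<le>M.
        (\<forall>p \<eta> m. set_pmf p \<subseteq> {1..n} \<and> (\<forall>k. 0 \<le> m k) \<longrightarrow>
           \<delta> * exp (- (4 * u / real n) * real K)
             \<le> measure_pmf.expectation (svrg ?d n f p \<eta> m 0 x0 K) (\<lambda>x. avg n f x - avg n f xs)) \<and>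
        (\<forall>\<eta> m. \<delta> * exp (- (4 * u / real n) * real K)
           \<le> measure_pmf.expectation (sarah ?d n f \<eta> m 0 x0 K) (\<lambda>x. avg n f x - avg n f xs)))"
      using quadratic.L_smooth[OF comp] quadratic.strongly_convex[OF comp]
        full.is_arg_min_stationary[OF xs stationary] gap svrg sarah by blast
  qed
  then show ?thesis unfolding slow_def u_def[symmetric] using \<delta> by blast
qed

section \<open>The complexity bound\<close>

lemma arsinh_nonneg: "0 \<le> x \<Longrightarrow> 0 \<le> arsinh (x :: real)"
  using arsinh_real_neg_iff[of x] by linarith

lemma arsinh_le: "0 \<le> x \<Longrightarrow> arsinh x \<le> (x :: real)"
  using real_le_x_sinh[of "arsinh x"] sinh_arsinh_real[of x] arsinh_nonneg[of x]
  by (simp add: sinh_field_def exp_minus)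

lemma arsinh_le_ln: 
  assumes "0 \<le> (x :: real)" shows "arsinh x \<le> ln (2 * x + 1)"
proof -
  have "sqrt (x\<^sup>2 + 1) \<le> x + 1"
    using assms by (intro real_le_lsqrt) (auto simp: power2_eq_square algebra_simps)
  then show ?thesis unfolding arsinh_real_def using assms arsinh_real_aux[of x]
    by (subst ln_le_cancel_iff) auto
qed

lemma one_plus_ln_le: 
  assumes "0 < r" shows "1 + ln r \<le> 2 * sqrt (r :: real)"
  using assms ln_le_minus_one[of "sqrt r"] by (simp add: ln_sqrt)

text \<open>Here \<open>r = n / \<kappa>\<close>. For \<open>r \<le> 1\<close> the square root bound
  on \<open>arsinh\<close> meets the dominant term \<open>1 / sqrt r\<close>; for larger
  \<open>r\<close> its logarithmic bound meets \<open>1 / (1 + ln r)\<close>, which then dominates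
  up to a factor.\<close>

lemma chain_rate_bound:
  assumes r: "0 < r" and \<rho>: "0 \<le> \<rho>" "\<rho> \<le> 2 * r"
  shows "arsinh (sqrt \<rho>) * (1 / (1 + max (ln r) 0) + 1 / sqrt r) \<le> 9 / 2"
proof (cases "r \<le> 1")
  case True
  then have ln: "max (ln r) 0 = 0" using r by simp
  have "1 \<le> 1 / sqrt r" "2 / sqrt r = 1 / sqrt r + 1 / sqrt r" using True r by simp_all
  then have "1 + 1 / sqrt r \<le> 2 / sqrt r" by linarith
  have "arsinh (sqrt \<rho>) \<le> sqrt \<rho>" using \<rho> by (intro arsinh_le) auto
  also have "\<dots> \<le> sqrt 2 * sqrt r" using \<rho> by (simp flip: real_sqrt_mult)
  finally have "arsinh (sqrt \<rho>) * (1 / (1 + max (ln r) 0) + 1 / sqrt r) \<le> (sqrt 2 * sqrt r) * (2 / sqrt r)"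
    using \<open>1 + 1 / sqrt r \<le> 2 / sqrt r\<close> \<rho> r unfolding ln by (intro mult_mono) auto
  also have "\<dots> = 2 * sqrt 2" using r by simp
  also have "\<dots> \<le> 9 / 2" using sqrt2_less_2 by simp
  finally show ?thesis .
next
  case False
  then have r1: "1 < r" and ln: "0 < ln r" "max (ln r) 0 = ln r" by auto
  have "1 \<le> sqrt r" using r1 by simp
  have "2 * sqrt \<rho> + 1 \<le> 2 * (sqrt 2 * sqrt r) + 1" using \<rho> by (simp flip: real_sqrt_mult)
  also have "\<dots> \<le> 2 * (3 / 2 * sqrt r) + sqrt r"
    using \<open>1 \<le> sqrt r\<close> by (intro add_mono mult_left_mono mult_right_mono real_le_lsqrt)
      (auto simp: power2_eq_square)
  finally have "2 * sqrt \<rho> + 1 \<le> 4 * sqrt r" by simp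
  have "arsinh (sqrt \<rho>) \<le> ln (2 * sqrt \<rho> + 1)" using \<rho> by (intro arsinh_le_ln) auto
  also have "\<dots> \<le> ln (4 * sqrt r)"
    using \<open>2 * sqrt \<rho> + 1 \<le> 4 * sqrt r\<close> \<rho> r by (subst ln_le_cancel_iff) (auto intro: add_nonneg_pos)
  also have "\<dots> = 2 * ln 2 + ln r / 2"
    using r ln_realpow[of 2 2] by (simp add: ln_mult ln_sqrt)
  also have "\<dots> \<le> 3 / 2 * (1 + ln r)" using ln2_le_25_over_36 ln by simp
  finally have 1: "arsinh (sqrt \<rho>) \<le> 3 / 2 * (1 + ln r)" .
  have "1 / sqrt r \<le> 2 / (1 + ln r)"
    using one_plus_ln_le[OF r] r ln by (simp add: field_simps add_pos_pos)
  then have 2: "1 / (1 + max (ln r) 0) + 1 / sqrt r \<le> 3 / (1 + ln r)" 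
    unfolding ln(2) by (simp add: add_divide_distrib[symmetric])
  have "arsinh (sqrt \<rho>) * (1 / (1 + max (ln r) 0) + 1 / sqrt r) \<le> (3 / 2 * (1 + ln r)) * (3 / (1 + ln r))"
    using 1 2 ln \<rho> r by (intro mult_mono) auto
  also have "\<dots> = 9 / 2" using ln by (simp add: divide_simps)
  finally show ?thesis .
qed

text \<open>\<open>B\<close> is a decay rate per evaluation and \<open>A\<close> the claimed cost
  per factor of accuracy, so an absolute bound on \<open>B * A\<close> is the rate claim. The chain
  serves for \<open>\<kappa> \<ge> 2\<close>, where
  \<open>n / (\<kappa> - 1) \<le> 2 * n / \<kappa>\<close>, and the staying argument below that. The
  18 is \<open>4 * (9 / 2)\<close>.\<close>

lemma slow_rate:
  assumes n: "1 \<le> n" and \<mu>: "0 < \<mu>" "\<mu> \<le> L" and \<Delta>: "0 < \<Delta>"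
  defines "A \<equiv> real n / (1 + max (ln (real n / (L / \<mu>))) 0) + sqrt (real n * (L / \<mu>))"
  shows "\<exists>B\<ge>0. B * A \<le> 18 \<and> slow n L \<mu> \<Delta> B"
proof -
  define \<kappa> where "\<kappa> = L / \<mu>"
  define r where "r = real n / \<kappa>"
  have \<kappa>: "1 \<le> \<kappa>" using \<mu> by (simp add: \<kappa>_def)
  have n0: "0 < real n" "1 \<le> real n" using n by auto
  have r: "0 < r" using n0 \<kappa> by (simp add: r_def)
  have "sqrt (real n * \<kappa>) = real n * (1 / sqrt r)"
  proof -
    have "real n * \<kappa> = (real n)\<^sup>2 / r" using n0 \<kappa> by (simp add: r_def power2_eq_square)
    then show ?thesis using n0 by (simp add: real_sqrt_divide)
  qed
  then have A: "A = real n * (1 / (1 + max (ln r) 0) + 1 / sqrt r)"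
    by (simp add: A_def r_def \<kappa>_def distrib_left)
  show ?thesis
  proof (cases "2 \<le> \<kappa>")
    case True
    let ?\<rho> = "real n / (\<kappa> - 1)"
    have "0 \<le> ?\<rho>" "?\<rho> \<le> 2 * r"
      using True n0 by (auto simp: r_def field_simps intro: mult_left_mono)
    from chain_rate_bound[OF r this] have "4 * arsinh (sqrt ?\<rho>) / real n * A \<le> 18"
      unfolding A using n0 by (simp add: mult.commute)
    moreover have "0 \<le> 4 * arsinh (sqrt ?\<rho>) / real n"
      using True n0 arsinh_nonneg[of "sqrt ?\<rho>"] by (intro divide_nonneg_pos) auto
    moreover have "\<mu> < L" using True \<mu> by (auto simp: \<kappa>_def pos_le_divide_eq)
    ultimately show ?thesis using slow_chain[OF n \<mu>(1) _ \<Delta>] unfolding \<kappa>_def by blast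
  next
    case False
    let ?l = "1 + ln (real n)"
    have l: "1 \<le> ?l" using n0 by simp
    have "ln \<kappa> \<le> ln 2" using False \<kappa> by simp
    then have "ln \<kappa> \<le> 1" using ln_2_less_1 by linarith
    then have "ln r \<ge> ln (real n) - 1"
      using n0 \<kappa> by (simp add: r_def ln_div)
    then have "?l \<le> 2 * (1 + max (ln r) 0)" using l by (auto simp: max_def)
    then have 1: "?l * (1 / (1 + max (ln r) 0)) \<le> 2" by (simp add: field_simps add_pos_nonneg)
    have "sqrt (real n) \<le> sqrt (2 * r)" using False n0 \<kappa> by (simp add: r_def field_simps)
    also have "\<dots> \<le> 2 * sqrt r" using r sqrt2_less_2 by (simp add: real_sqrt_mult)
    finally have "?l \<le> 4 * sqrt r" using one_plus_ln_le[OF n0(1)] by simp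
    then have 2: "?l * (1 / sqrt r) \<le> 4" using r by (simp add: field_simps)
    have "2 * ?l / real n * A = 2 * (?l * (1 / (1 + max (ln r) 0)) + ?l * (1 / sqrt r))"
      unfolding A distrib_left[symmetric] using n0 by simp
    also have "\<dots> \<le> 2 * (2 + 4)" by (intro mult_left_mono add_mono 1 2) simp
    finally have "2 * ?l / real n * A \<le> 18" by simp
    moreover have "0 \<le> 2 * ?l / real n" using l n0 by simp
    ultimately show ?thesis using slow_well_conditioned[OF n \<mu> \<Delta>] by blast
  qed
qed

text \<open>Prescribing the initial gap excludes hardness by mere scaling. The constant
  \<open>c\<close> is uniform in all parameters; low-accuracy effects go into the threshold on
  \<open>\<epsilon>\<close>.\<close>

theorem theorem2:
  "\<exists>c::real>0. \<forall>(n::nat) (L::real) (\<mu>::real) (\<Delta>::real).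
     1 \<le> n \<and> 0 < \<mu> \<and> \<mu> \<le> L \<and> 0 < \<Delta> \<longrightarrow>
     (\<exists>\<epsilon>\<^sub>0>0. \<forall>\<epsilon>. 0 < \<epsilon> \<and> \<epsilon> < \<epsilon>\<^sub>0 \<longrightarrow>
       (\<exists>d. \<forall>x0\<in>Rn d. \<exists>(f :: nat \<Rightarrow> point \<Rightarrow> real) xs.
          (\<forall>i\<in>{1..n}. L_smooth d L (f i) \<and> strongly_convex d \<mu> (f i)) \<and>
          is_arg_min (avg n f) (\<lambda>x. x \<in> Rn d) xs \<and>
          avg n f x0 - avg n f xs = \<Delta> \<and>
          (\<forall>K::nat.
             (let \<kappa> = L / \<mu> in
              real K < c * ((real n / (1 + max (ln (real n / \<kappa>)) 0) + sqrt (real n * \<kappa>)) * ln (1 / \<epsilon>)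
                            + real n)) \<longrightarrow>
             (\<forall>p \<eta> m. set_pmf p \<subseteq> {1..n} \<and> (\<forall>k. 0 \<le> m k) \<longrightarrow>
                \<epsilon> \<le> measure_pmf.expectation (svrg d n f p \<eta> m 0 x0 K) (\<lambda>x. avg n f x - avg n f xs)) \<and>
             (\<forall>\<eta> m.
                \<epsilon> \<le> measure_pmf.expectation (sarah d n f \<eta> m 0 x0 K) (\<lambda>x. avg n f x - avg n f xs)))))"
\<comment> \<open>\<open>72 = 2 * 2 * 18\<close>: one factor 2 absorbs the additive
  \<open>n\<close>, the other leaves half of the exponent for \<open>\<delta>\<close>, and 18 bounds
  \<open>B * A\<close>.\<close>
proof (rule exI[of _ "1 / 72"], intro conjI allI impI, goal_cases)
  case 1
  show ?case by simp
next
  case (2 n L \<mu> \<Delta>)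
  then have n: "1 \<le> n" and \<mu>: "0 < \<mu>" "\<mu> \<le> L" and \<Delta>: "0 < \<Delta>" by auto
  define A where "A = real n / (1 + max (ln (real n / (L / \<mu>))) 0) + sqrt (real n * (L / \<mu>))"
  have A: "0 < A"
    using n \<mu> unfolding A_def by (intro add_nonneg_pos) auto
  from slow_rate[OF n \<mu> \<Delta>] obtain B where B: "0 \<le> B" "B * A \<le> 18" and "slow n L \<mu> \<Delta> B"
    unfolding A_def by blast
  then obtain \<delta> where \<delta>: "0 < \<delta>"
    and slow: "lower_bound n L \<mu> \<Delta> (\<lambda>K. K \<le> M) (\<lambda>K. \<delta> * exp (- B * real K))" for M
    unfolding slow_def by blast
  \<comment> \<open>The first bound gives \<open>n \<le> A * ln (1 / \<epsilon>)\<close>. The second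
    gives \<open>sqrt \<epsilon> \<le> \<delta>\<close>, which supplies one of the two factors
    \<open>sqrt \<epsilon>\<close>.\<close>
  define \<epsilon>\<^sub>0 where "\<epsilon>\<^sub>0 = min (exp (- real n / A)) (\<delta>\<^sup>2)"
  show ?case
    unfolding Let_def A_def[symmetric] lower_bound_def[symmetric]
  proof (intro exI[of _ \<epsilon>\<^sub>0] conjI allI impI)
    show "0 < \<epsilon>\<^sub>0" using \<delta> by (simp add: \<epsilon>\<^sub>0_def)
    fix \<epsilon> assume "0 < \<epsilon> \<and> \<epsilon> < \<epsilon>\<^sub>0"
    then have \<epsilon>: "0 < \<epsilon>" "\<epsilon> < \<epsilon>\<^sub>0" by auto
    define l where "l = ln (1 / \<epsilon>)"
    have "\<epsilon> \<le> exp (- real n / A)" using \<epsilon> by (simp add: \<epsilon>\<^sub>0_def)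
    then have "ln \<epsilon> \<le> - real n / A" using \<epsilon>(1) by (metis exp_le_cancel_iff exp_ln)
    then have "real n \<le> A * l" using A \<epsilon> by (simp add: l_def ln_div field_simps)
    define M where "M = nat \<lceil>A * l\<rceil>"
    have bound: "K \<le> M \<and> \<epsilon> \<le> \<delta> * exp (- B * real K)"
      if "real K < 1 / 72 * (A * l + real n)" for K
    proof
      from that \<open>real n \<le> A * l\<close> have K: "real K \<le> A * l / 36" by simp
      then show "K \<le> M" using \<open>real n \<le> A * l\<close> unfolding M_def by linarith
      have "0 \<le> l" using A \<open>real n \<le> A * l\<close> n by (metis of_nat_0_le_iff order_trans zero_le_mult_iff not_le)
      have "B * real K \<le> B * (A * l / 36)" using B K by (intro mult_left_mono)
      also have "\<dots> = B * A * (l / 36)" by simp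
      also have "\<dots> \<le> 18 * (l / 36)" using B \<open>0 \<le> l\<close> by (intro mult_right_mono) auto
      finally have "ln (sqrt \<epsilon>) \<le> - B * real K" using \<epsilon> by (simp add: l_def ln_div ln_sqrt)
      then have "sqrt \<epsilon> \<le> exp (- B * real K)" using \<epsilon> by (metis exp_le_cancel_iff exp_ln real_sqrt_gt_zero)
      moreover have "sqrt \<epsilon> \<le> \<delta>" using \<epsilon> \<delta> by (intro real_le_lsqrt) (auto simp: \<epsilon>\<^sub>0_def)
      ultimately have "sqrt \<epsilon> * sqrt \<epsilon> \<le> \<delta> * exp (- B * real K)" using \<epsilon> \<delta> by (intro mult_mono) auto
      then show "\<epsilon> \<le> \<delta> * exp (- B * real K)" using \<epsilon> by simp
    qed
    show "lower_bound n L \<mu> \<Delta> (\<lambda>K. real K < 1 / 72 * (A * ln (1 / \<epsilon>) + real n)) (\<lambda>_. \<epsilon>)"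
      using bound unfolding l_def by (rule lower_bound_mono[OF slow])
  qed
qed

end
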